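(* The vector field $J_{AB}:\Theta\to\mathbb{R}^d$ given by $$\begin{aligned}J_{AB}(x)=&\Big(b(x)+\Sigma(x)\frac{\nabla q(x)}{q(x)}-\int_{|r|<1}F(x,r)\,\nu(\mathrm{d}r)\Big)\rho(x)q(x)\overleftarrow q(x)\\&+\int_{|r|<1}\int_0^1F\big(\mathcal{T}^{-1}_{F,\theta,r}(x),r\big)\,q\big(\mathcal{T}^{-1}_{F,\theta,r}(x)+F(\mathcal{T}^{-1}_{F,\theta,r}(x),r)\big)\,\rho\big(\mathcal{T}^{-1}_{F,\theta,r}(x)\big)\,\overleftarrow q\big(\mathcal{T}^{-1}_{F,\theta,r}(x)\big)\,|\mathcal{J}_{F,\theta,r}(x)|\,\mathrm{d}\theta\,\nu(\mathrm{d}r)\\&+\frac12\,\mathrm{div}\big(\Sigma(x)\rho(x)q(x)\overleftarrow q(x)\big)\end{aligned}$$ is the probability current of the $AB$-transition trajectories.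
   Context: Setting. On a filtered probability space satisfying the usual conditions, $X$ is the càdlàg solution in $\mathbb{R}^d$ of $$\mathrm{d}X_t=b(X_{t-})\,\mathrm{d}t+\sigma(X_{t-})\,\mathrm{d}B_t+\int_{|r|<1}F(X_{t-},r)\,\widetilde N(\mathrm{d}r,\mathrm{d}t),$$ with $B_\cdot$ a $d$-dimensional Brownian motion, $N$ an independent Poisson random measure with intensity $\nu(\mathrm{d}r)\,\mathrm{d}t$, $\widetilde N$ its compensated version, $\nu$ a Lévy measure, and $b,\sigma,F$ measurable. $\Sigma=\sigma\sigma^\top$. Generator: $$\mathcal{L}f(x)=b(x)\cdot\nabla f(x)+\tfrac12\sum_{i,j}\Sigma_{ij}(x)\partial_{ij}f(x)+\int_{|r|<1}\big[f(x+F(x,r))-f(x)-F(x,r)\cdot\nabla f(x)\big]\nu(\mathrm{d}r).$$ Standing assumption 1. $b,\sigma,F$ are such that the Markov process $X$ is ergodic and has a unique invariant probability density $\rho>0$; for $\theta\in[0,1]$ the map $\mathcal{T}_{F,\theta,r}:x\mapsto x+\theta F(x,r)$ is invertible, $|\mathcal{J}_{F,\theta,r}(x)|$ is the Jacobian determinant of its inverse $\mathcal{T}^{-1}_{F,\theta,r}$, and $\rho$ satisfies $$-\nabla\cdot\Big[\Big(b-\int_{|r|<1}F(\cdot,r)\nu(\mathrm{d}r)\Big)\rho\Big]+\tfrac12\sum_{i,j}\partial_{ij}(\Sigma_{ij}\rho)-\nabla\cdot\int_{|r|<1}\int_0^1F(\mathcal{T}^{-1}_{F,\theta,r}(x),r)\,\rho(\mathcal{T}^{-1}_{F,\theta,r}(x))\,|\mathcal{J}_{F,\theta,r}(x)|\,\mathrm{d}\theta\,\nu(\mathrm{d}r)=0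 .$$ Standing assumption 2. $A,B\subset\mathbb{R}^d$ are disjoint open sets with smooth boundary, and $|x-y|>1$ for all $x\in A$, $y\in B$. Committors. $\Theta=\mathbb{R}^d\setminus(\bar A\cup\bar B)$. Forward committor: $q(x)=\mathbb{P}(X\text{ hits }\bar B\text{ before }\bar A\mid X_0=x)$; it is $C^2$ on $\Theta$ with $0<q<1$ there, and satisfies $\mathcal{L}q=0$ on $\Theta$, $q=0$ on $\bar A$, $q=1$ on $\bar B$. Backward committor: with $\overleftarrow{\mathcal{L}}$ the adjoint of $\mathcal{L}$ in $L^2(\mathbb{R}^d,\rho(x)\mathrm{d}x)$ (generator of the time-reversed process), $\overleftarrow q$ is the unique solution of $\overleftarrow{\mathcal{L}}\overleftarrow q=0$ on $\Theta$, $\overleftarrow q=1$ on $\bar A$, $\overleftarrow q=0$ on $\bar B$. Transition trajectories and current. $AB$-transition trajectories are the pieces of the trajectory of $X$ between last leaving $\bar A$ and next entering $\bar B$; their (unnormalized) stationary density is $\rho_{\mathcal{R}_{A\to B}}=\rho\,q\,\overleftarrow q$. The transition path process, which has the law of these trajectories, is the Doob transform of $X$ by $q$, with generator $\mathcal{L}^qf=q^{-1}\mathcal{L}(qf)$; $(\mathcal{L}^q)^*$ is the adjoint of $\mathcal{L}^q$. The probability current of the $AB$-transition trajectories is the vector field $J_{AB}$ that appears when the stationary forward equation $(\mathcal{L}^q)^*\rho_{\mathcal{R}_{A\to B}}=0$ on $\Theta$ is written in divergence form $-\nabla\cdot J_{AB}=0$. For a matrix field $M$, $\mathrm{div}\,M$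 is the vector field with components $\sum_j\partial_jM_{ij}$.
   Formalization: The divergence term is taken with sign −½ instead of the printed +½ (with + the field is not divergence free, e.g. Ornstein–Uhlenbeck without jumps); equations are read in the distributional sense, with the displayed integrals locally integrable and Σρq times the backward committor C¹ on Θ. *)

theory Defs
  imports "HOL-Probability.Probability"
begin

section \<open>Calculus on Euclidean space\<close>

definition partial :: "'n \<Rightarrow> (real^'n \<Rightarrow> real) \<Rightarrow> real^'n \<Rightarrow> real" where
  "partial i f x = deriv (\<lambda>t. f (x + t *\<^sub>R axis i 1)) 0"

definition grad :: "(real^'n \<Rightarrow> real) \<Rightarrow> real^'n \<Rightarrow> real^'n" where
  "grad f x = (\<chi> i. partial i f x)"

definition matrix_div :: "(real^'n \<Rightarrow> real^'n^'n) \<Rightarrow> real^'n \<Rightarrow> real^'n" where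
  "matrix_div M x = (\<chi> i. \<Sum>j\<in>UNIV. partial j (\<lambda>y. M y $ i $ j) x)"

text \<open>Meant for open \<open>S\<close>.\<close>

primrec Ck_on :: "nat \<Rightarrow> (real^'n) set \<Rightarrow> (real^'n \<Rightarrow> real) \<Rightarrow> bool" where
  "Ck_on 0 S f \<longleftrightarrow> continuous_on S f"
| "Ck_on (Suc k) S f \<longleftrightarrow>
     (\<forall>x\<in>S. f differentiable (at x)) \<and> (\<forall>i. Ck_on k S (partial i f))"

text \<open>Test functions: \<open>C\<^sup>2\<close>, with compact support contained in \<open>S\<close>.\<close>

definition C2c :: "(real^'n) set \<Rightarrow> (real^'n \<Rightarrow> real) set" where
  "C2c S = {f. Ck_on 2 UNIV f \<and> compact (closure {x. f x \<noteq> 0}) \<and> closure {x. f x \<noteq> 0} \<subseteq> S}"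

definition locally_integrable_on ::
    "(real^'n) set \<Rightarrow> (real^'n \<Rightarrow> 'b::{banach, second_countable_topology}) \<Rightarrow> bool" where
  "locally_integrable_on S f \<longleftrightarrow> (\<forall>K. compact K \<and> K \<subseteq> S \<longrightarrow> set_integrable lborel K f)"

definition smooth_boundary :: "(real^'n) set \<Rightarrow> bool" where
  "smooth_boundary A \<longleftrightarrow>
     (\<forall>z\<in>frontier A. \<exists>V \<phi>. open V \<and> z \<in> V \<and> (\<forall>k. Ck_on k V \<phi>) \<and>
        (\<forall>x\<in>V. grad \<phi> x \<noteq> 0) \<and> A \<inter> V = {x \<in> V. \<phi> x < 0})"


section \<open>Driving noise and stochastic integrals\<close>

text \<open>Time is \<open>real\<close>; only indices \<open>t \<ge> 0\<close> matter.\<close>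

definition usual_filtration :: "'w measure \<Rightarrow> (real \<Rightarrow> 'w measure) \<Rightarrow> bool" where
  "usual_filtration M \<F> \<longleftrightarrow>
     prob_space M \<and> filtration (space M) \<F> \<and> (\<forall>t. sets (\<F> t) \<subseteq> sets M) \<and>
     (\<forall>Z\<in>null_sets M. \<forall>Y\<subseteq>Z. Y \<in> sets (\<F> 0)) \<and>
     (\<forall>t\<ge>0. (\<Inter>u\<in>{t<..}. sets (\<F> u)) = sets (\<F> t))"

definition cadlag_paths :: "'w measure \<Rightarrow> (real \<Rightarrow> 'w \<Rightarrow> real^'n) \<Rightarrow> bool" where
  "cadlag_paths M Y \<longleftrightarrow>
     (\<forall>\<omega>\<in>space M. (\<forall>t\<ge>0. ((\<lambda>s. Y s \<omega>) \<longlongrightarrow> Y t \<omega>) (at_right t)) \<and>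
                 (\<forall>t>0. \<exists>l. ((\<lambda>s. Y s \<omega>) \<longlongrightarrow> l) (at_left t)))"

definition left_lim :: "(real \<Rightarrow> 'w \<Rightarrow> real^'n) \<Rightarrow> real \<Rightarrow> 'w \<Rightarrow> real^'n" where
  "left_lim Y t \<omega> = (if t \<le> 0 then Y 0 \<omega> else Lim (at_left t) (\<lambda>s. Y s \<omega>))"

definition brownian_motion ::
    "'w measure \<Rightarrow> (real \<Rightarrow> 'w measure) \<Rightarrow> (real \<Rightarrow> 'w \<Rightarrow> real^'n) \<Rightarrow> bool" where
  "brownian_motion M \<F> W \<longleftrightarrow>
     (\<forall>t\<ge>0. W t \<in> borel_measurable (\<F> t)) \<and>
     (AE \<omega> in M. W 0 \<omega> = 0) \<and>
     (\<forall>\<omega>\<in>space M. continuous_on {0..} (\<lambda>t. W t \<omega>)) \<and>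
     (\<forall>s t. 0 \<le> s \<and> s < t \<longrightarrow>
        distr M borel (\<lambda>\<omega>. W t \<omega> - W s \<omega>) =
          density lborel (\<lambda>x. ennreal (\<Prod>i\<in>UNIV. normal_density 0 (sqrt (t - s)) (x $ i))) \<and>
        prob_space.indep_set M (sets (\<F> s))
          {(\<lambda>\<omega>. W t \<omega> - W s \<omega>) -` C \<inter> space M | C. C \<in> sets borel})"

definition levy_measure :: "(real^'m) measure \<Rightarrow> bool" where
  "levy_measure \<nu> \<longleftrightarrow> sets \<nu> = sets borel \<and> emeasure \<nu> {0} = 0 \<and>
     (\<integral>\<^sup>+ r. ennreal (min 1 ((norm r)\<^sup>2)) \<partial>\<nu>) < \<infinity>"

text \<open>The intensity \<open>\<nu>(dr) dt\<close> on marks \<open>\<times>\<close> positive times.\<close>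

definition intensity :: "(real^'m) measure \<Rightarrow> ((real^'m) \<times> real) measure" where
  "intensity \<nu> = \<nu> \<Otimes>\<^sub>M density lborel (indicator {0<..})"

text \<open>\<open>N \<omega>\<close> is the random measure on marks \<open>\<times>\<close> time.\<close>

definition count_events ::
    "'w measure \<Rightarrow> ('w \<Rightarrow> ((real^'m) \<times> real) measure) \<Rightarrow> ((real^'m) \<times> real) set \<Rightarrow> 'w set set" where
  "count_events M N D = sigma_sets (space M)
     {(\<lambda>\<omega>. emeasure (N \<omega>) S) -` C \<inter> space M | S C. S \<in> sets borel \<and> S \<subseteq> D \<and> C \<in> sets borel}"

definition poisson_random_measure ::
    "'w measure \<Rightarrow> (real \<Rightarrow> 'w measure) \<Rightarrow> (real^'m) measure \<Rightarrow>
     ('w \<Rightarrow> ((real^'m) \<times> real) measure) \<Rightarrow> bool" where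
  "poisson_random_measure M \<F> \<nu> N \<longleftrightarrow>
     (\<forall>\<omega>\<in>space M. sets (N \<omega>) = sets borel) \<and>
     (\<forall>S\<in>sets borel. (\<lambda>\<omega>. emeasure (N \<omega>) S) \<in> borel_measurable M) \<and>
     (\<forall>S\<in>sets borel. emeasure (intensity \<nu>) S < \<infinity> \<longrightarrow>
        (\<forall>k::nat. measure M {\<omega>\<in>space M. emeasure (N \<omega>) S = of_nat k} =
           measure (intensity \<nu>) S ^ k / fact k * exp (- measure (intensity \<nu>) S))) \<and>
     (\<forall>(n::nat) S. (\<forall>i<n. S i \<in> sets borel) \<and> disjoint_family_on S {..<n} \<longrightarrow>
        prob_space.indep_vars M (\<lambda>_. borel) (\<lambda>i \<omega>. emeasure (N \<omega>) (S i)) {..<n}) \<and>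
     (\<forall>t\<ge>0. count_events M N (UNIV \<times> {..t}) \<subseteq> sets (\<F> t)) \<and>
     (\<forall>t\<ge>0. prob_space.indep_set M (sets (\<F> t)) (count_events M N (UNIV \<times> {t<..})))"

definition path_events :: "'w measure \<Rightarrow> (real \<Rightarrow> 'w \<Rightarrow> real^'n) \<Rightarrow> 'w set set" where
  "path_events M W = sigma_sets (space M)
     {W t -` C \<inter> space M | t C. 0 \<le> t \<and> C \<in> sets borel}"

definition to_zero_in_prob :: "'w measure \<Rightarrow> (nat \<Rightarrow> 'w \<Rightarrow> ennreal) \<Rightarrow> bool" where
  "to_zero_in_prob M Z \<longleftrightarrow> (\<forall>n. Z n \<in> borel_measurable M) \<and>
     (\<forall>\<epsilon>>0. (\<lambda>n. measure M {\<omega>\<in>space M. Z n \<omega> \<ge> ennreal \<epsilon>}) \<longlonglongrightarrow> 0)"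

text \<open>
  An elementary integrand for \<open>W\<close> is a finite sum of \<open>\<xi>(\<omega>) 1\<^bsub>(a,u]\<^esub>(s)\<close> with
  \<open>\<xi>\<close> bounded and \<open>\<F> a\<close>-measurable, coded as the list of the triples \<open>(a,u,\<xi>)\<close>.
  The integral of a general integrand is the limit in probability of elementary integrals,
  along elementary integrands that converge in \<open>L\<^sup>2(ds)\<close> in probability on bounded time intervals.
\<close>

definition elementary_W ::
    "'w measure \<Rightarrow> (real \<Rightarrow> 'w measure) \<Rightarrow> (real \<times> real \<times> ('w \<Rightarrow> real^'n^'n)) list \<Rightarrow> bool" where
  "elementary_W M \<F> L \<longleftrightarrow> (\<forall>(a, u, \<xi>)\<in>set L. 0 \<le> a \<and> a \<le> u \<and>
     \<xi> \<in> borel_measurable (\<F> a) \<and> bounded (\<xi> ` space M))"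

definition elementary_W_value ::
    "(real \<times> real \<times> ('w \<Rightarrow> real^'n^'n)) list \<Rightarrow> real \<Rightarrow> 'w \<Rightarrow> real^'n^'n" where
  "elementary_W_value L s \<omega> = (\<Sum>(a, u, \<xi>)\<leftarrow>L. indicator {a<..u} s *\<^sub>R \<xi> \<omega>)"

definition elementary_W_integral ::
    "(real \<Rightarrow> 'w \<Rightarrow> real^'n) \<Rightarrow> (real \<times> real \<times> ('w \<Rightarrow> real^'n^'n)) list \<Rightarrow>
     real \<Rightarrow> 'w \<Rightarrow> real^'n" where
  "elementary_W_integral W L t \<omega> =
     (\<Sum>(a, u, \<xi>)\<leftarrow>L. \<xi> \<omega> *v (W (min t u) \<omega> - W (min t a) \<omega>))"

definition ito_integral ::
    "'w measure \<Rightarrow> (real \<Rightarrow> 'w measure) \<Rightarrow> (real \<Rightarrow> 'w \<Rightarrow> real^'n) \<Rightarrow>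
     (real \<Rightarrow> 'w \<Rightarrow> real^'n^'n) \<Rightarrow> (real \<Rightarrow> 'w \<Rightarrow> real^'n) \<Rightarrow> bool" where
  "ito_integral M \<F> W H I \<longleftrightarrow> (\<exists>L. (\<forall>n. elementary_W M \<F> (L n)) \<and>
     (\<forall>t\<ge>0.
        to_zero_in_prob M (\<lambda>n \<omega>. \<integral>\<^sup>+ s\<in>{0..t}.
          ennreal ((norm (elementary_W_value (L n) s \<omega> - H s \<omega>))\<^sup>2) \<partial>lborel) \<and>
        to_zero_in_prob M (\<lambda>n \<omega>. ennreal (norm (elementary_W_integral W (L n) t \<omega> - I t \<omega>)))))"

text \<open>
  Likewise for the compensated random measure: the elementary integrands are finite sums of
  \<open>\<xi>(\<omega>) 1\<^bsub>(a,u]\<^esub>(s) 1\<^bsub>E\<^esub>(r)\<close> with \<open>E\<close> a Borel set of marks in the open unit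
  ball, of finite \<open>\<nu>\<close>-measure.
\<close>

definition elementary_N ::
    "'w measure \<Rightarrow> (real \<Rightarrow> 'w measure) \<Rightarrow> (real^'m) measure \<Rightarrow>
     (real \<times> real \<times> (real^'m) set \<times> ('w \<Rightarrow> real^'n)) list \<Rightarrow> bool" where
  "elementary_N M \<F> \<nu> L \<longleftrightarrow> (\<forall>(a, u, E, \<xi>)\<in>set L. 0 \<le> a \<and> a \<le> u \<and>
     E \<in> sets borel \<and> E \<subseteq> ball 0 1 \<and> emeasure \<nu> E < \<infinity> \<and>
     \<xi> \<in> borel_measurable (\<F> a) \<and> bounded (\<xi> ` space M))"

definition elementary_N_value ::
    "(real \<times> real \<times> (real^'m) set \<times> ('w \<Rightarrow> real^'n)) list \<Rightarrow> real^'m \<Rightarrow> real \<Rightarrow> 'w \<Rightarrow> real^'n" where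
  "elementary_N_value L r s \<omega> =
     (\<Sum>(a, u, E, \<xi>)\<leftarrow>L. (indicator {a<..u} s * indicator E r) *\<^sub>R \<xi> \<omega>)"

definition elementary_N_integral ::
    "(real^'m) measure \<Rightarrow> ('w \<Rightarrow> ((real^'m) \<times> real) measure) \<Rightarrow>
     (real \<times> real \<times> (real^'m) set \<times> ('w \<Rightarrow> real^'n)) list \<Rightarrow> real \<Rightarrow> 'w \<Rightarrow> real^'n" where
  "elementary_N_integral \<nu> N L t \<omega> =
     (\<Sum>(a, u, E, \<xi>)\<leftarrow>L. (measure (N \<omega>) (E \<times> {min t a<..min t u})
                          - measure \<nu> E * (min t u - min t a)) *\<^sub>R \<xi> \<omega>)"

definition compensated_integral ::
    "'w measure \<Rightarrow> (real \<Rightarrow> 'w measure) \<Rightarrow> (real^'m) measure \<Rightarrow>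
     ('w \<Rightarrow> ((real^'m) \<times> real) measure) \<Rightarrow>
     (real^'m \<Rightarrow> real \<Rightarrow> 'w \<Rightarrow> real^'n) \<Rightarrow> (real \<Rightarrow> 'w \<Rightarrow> real^'n) \<Rightarrow> bool" where
  "compensated_integral M \<F> \<nu> N G I \<longleftrightarrow> (\<exists>L. (\<forall>n. elementary_N M \<F> \<nu> (L n)) \<and>
     (\<forall>t\<ge>0.
        to_zero_in_prob M (\<lambda>n \<omega>. \<integral>\<^sup>+ s\<in>{0..t}. (\<integral>\<^sup>+ r\<in>ball 0 1.
          ennreal ((norm (elementary_N_value (L n) r s \<omega> - G r s \<omega>))\<^sup>2) \<partial>\<nu>) \<partial>lborel) \<and>
        to_zero_in_prob M (\<lambda>n \<omega>. ennreal (norm (elementary_N_integral \<nu> N (L n) t \<omega> - I t \<omega>)))))"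


section \<open>The jump diffusion as a Markov process\<close>

text \<open>\<open>Y\<close> is a cadlag solution started at \<open>x\<close>.\<close>

definition solves_sde ::
    "'w measure \<Rightarrow> (real \<Rightarrow> 'w measure) \<Rightarrow> (real \<Rightarrow> 'w \<Rightarrow> real^'n) \<Rightarrow>
     (real^'m) measure \<Rightarrow> ('w \<Rightarrow> ((real^'m) \<times> real) measure) \<Rightarrow>
     (real^'n \<Rightarrow> real^'n) \<Rightarrow> (real^'n \<Rightarrow> real^'n^'n) \<Rightarrow> (real^'n \<Rightarrow> real^'m \<Rightarrow> real^'n) \<Rightarrow>
     real^'n \<Rightarrow> (real \<Rightarrow> 'w \<Rightarrow> real^'n) \<Rightarrow> bool" where
  "solves_sde M \<F> W \<nu> N b \<sigma> F x Y \<longleftrightarrow>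
     cadlag_paths M Y \<and> (\<forall>t\<ge>0. Y t \<in> borel_measurable (\<F> t)) \<and>
     (\<exists>I K. ito_integral M \<F> W (\<lambda>s \<omega>. \<sigma> (left_lim Y s \<omega>)) I \<and>
            compensated_integral M \<F> \<nu> N (\<lambda>r s \<omega>. F (left_lim Y s \<omega>) r) K \<and>
            (\<forall>t\<ge>0. AE \<omega> in M.
               set_integrable lborel {0..t} (\<lambda>s. b (left_lim Y s \<omega>)) \<and>
               Y t \<omega> = x + (LINT s:{0..t}|lborel. b (left_lim Y s \<omega>)) + I t \<omega> + K t \<omega>))"

text \<open>\<open>X x\<close> is the process started at \<open>x\<close>.\<close>

definition transition_prob ::
    "'w measure \<Rightarrow> (real^'n \<Rightarrow> real \<Rightarrow> 'w \<Rightarrow> real^'n) \<Rightarrow> real \<Rightarrow> real^'n \<Rightarrow> (real^'n) set \<Rightarrow> real" where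
  "transition_prob M X t x S = measure M {\<omega>\<in>space M. X x t \<omega> \<in> S}"

definition markov_process ::
    "'w measure \<Rightarrow> (real \<Rightarrow> 'w measure) \<Rightarrow> (real^'n \<Rightarrow> real \<Rightarrow> 'w \<Rightarrow> real^'n) \<Rightarrow> bool" where
  "markov_process M \<F> X \<longleftrightarrow>
     (\<forall>t\<ge>0. \<forall>S\<in>sets borel. (\<lambda>x. transition_prob M X t x S) \<in> borel_measurable borel) \<and>
     (\<forall>x. \<forall>s\<ge>0. \<forall>t\<ge>0. \<forall>S\<in>sets borel. \<forall>E\<in>sets (\<F> s).
        measure M {\<omega>\<in>E. X x (s + t) \<omega> \<in> S} =
          (LINT \<omega>:E|M. transition_prob M X t (X x s \<omega>) S))"

definition invariant_density ::
    "'w measure \<Rightarrow> (real^'n \<Rightarrow> real \<Rightarrow> 'w \<Rightarrow> real^'n) \<Rightarrow> (real^'n \<Rightarrow> real) \<Rightarrow> bool" where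
  "invariant_density M X \<rho> \<longleftrightarrow>
     \<rho> \<in> borel_measurable borel \<and> (\<forall>x. 0 \<le> \<rho> x) \<and> (\<integral>\<^sup>+ x. ennreal (\<rho> x) \<partial>lborel) = 1 \<and>
     (\<forall>t\<ge>0. \<forall>S\<in>sets borel.
        (\<integral>\<^sup>+ x. ennreal (\<rho> x * transition_prob M X t x S) \<partial>lborel) =
        (\<integral>\<^sup>+ x\<in>S. ennreal (\<rho> x) \<partial>lborel))"

definition ergodic_density ::
    "'w measure \<Rightarrow> (real^'n \<Rightarrow> real \<Rightarrow> 'w \<Rightarrow> real^'n) \<Rightarrow> (real^'n \<Rightarrow> real) \<Rightarrow> bool" where
  "ergodic_density M X \<rho> \<longleftrightarrow>
     (\<forall>S\<in>sets borel.
        (\<forall>t\<ge>0. AE x in density lborel (\<lambda>y. ennreal (\<rho> y)). transition_prob M X t x S = indicator S x) \<longrightarrow>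
        emeasure (density lborel (\<lambda>y. ennreal (\<rho> y))) S \<in> {0, 1})"

definition hitting_time :: "(real^'n) set \<Rightarrow> (real \<Rightarrow> 'w \<Rightarrow> real^'n) \<Rightarrow> 'w \<Rightarrow> ereal" where
  "hitting_time S Y \<omega> = Inf {ereal t | t. 0 \<le> t \<and> Y t \<omega> \<in> S}"

definition forward_committor ::
    "'w measure \<Rightarrow> (real^'n \<Rightarrow> real \<Rightarrow> 'w \<Rightarrow> real^'n) \<Rightarrow> (real^'n) set \<Rightarrow> (real^'n) set \<Rightarrow>
     real^'n \<Rightarrow> real" where
  "forward_committor M X A B x =
     measure M {\<omega>\<in>space M. hitting_time (closure B) (X x) \<omega> < hitting_time (closure A) (X x) \<omega>}"


section \<open>Generators and their adjoints\<close>

definition diffusion_matrix :: "(real^'n \<Rightarrow> real^'n^'n) \<Rightarrow> real^'n \<Rightarrow> real^'n^'n" where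
  "diffusion_matrix \<sigma> x = \<sigma> x ** transpose (\<sigma> x)"

definition generator ::
    "(real^'n \<Rightarrow> real^'n) \<Rightarrow> (real^'n \<Rightarrow> real^'n^'n) \<Rightarrow> (real^'n \<Rightarrow> real^'m \<Rightarrow> real^'n) \<Rightarrow>
     (real^'m) measure \<Rightarrow> (real^'n \<Rightarrow> real) \<Rightarrow> real^'n \<Rightarrow> real" where
  "generator b \<sigma> F \<nu> f x =
     b x \<bullet> grad f x
     + 1/2 * (\<Sum>i\<in>UNIV. \<Sum>j\<in>UNIV. diffusion_matrix \<sigma> x $ i $ j * partial i (partial j f) x)
     + (LINT r:ball 0 1|\<nu>. f (x + F x r) - f x - F x r \<bullet> grad f x)"

text \<open>The value of the adjoint of \<open>L\<close> in \<open>L\<^sup>2(\<mu>)\<close> at \<open>g\<close> is \<open>k\<close> on the open set \<open>S\<close>,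
  tested against \<open>C\<^sup>2\<close> functions supported in \<open>S\<close>.\<close>

definition adjoint_value ::
    "((real^'n \<Rightarrow> real) \<Rightarrow> real^'n \<Rightarrow> real) \<Rightarrow> (real^'n) measure \<Rightarrow> (real^'n) set \<Rightarrow>
     (real^'n \<Rightarrow> real) \<Rightarrow> (real^'n \<Rightarrow> real) \<Rightarrow> bool" where
  "adjoint_value L \<mu> S g k \<longleftrightarrow>
     (\<forall>f\<in>C2c S. integrable \<mu> (\<lambda>x. g x * L f x) \<and> integrable \<mu> (\<lambda>x. k x * f x) \<and>
        (LINT x|\<mu>. g x * L f x) = (LINT x|\<mu>. k x * f x))"

definition backward_committor_equation ::
    "((real^'n \<Rightarrow> real) \<Rightarrow> real^'n \<Rightarrow> real) \<Rightarrow> (real^'n \<Rightarrow> real) \<Rightarrow>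
     (real^'n) set \<Rightarrow> (real^'n) set \<Rightarrow> (real^'n \<Rightarrow> real) \<Rightarrow> bool" where
  "backward_committor_equation L \<rho> A B g \<longleftrightarrow>
     g \<in> borel_measurable borel \<and> (\<forall>x. 0 \<le> g x \<and> g x \<le> 1) \<and>
     (\<forall>x\<in>closure A. g x = 1) \<and> (\<forall>x\<in>closure B. g x = 0) \<and>
     adjoint_value L (density lborel (\<lambda>y. ennreal (\<rho> y))) (- (closure A \<union> closure B)) g (\<lambda>_. 0)"

definition doob_transform ::
    "((real^'n \<Rightarrow> real) \<Rightarrow> real^'n \<Rightarrow> real) \<Rightarrow> (real^'n \<Rightarrow> real) \<Rightarrow>
     (real^'n \<Rightarrow> real) \<Rightarrow> real^'n \<Rightarrow> real" where
  "doob_transform L q f x = L (\<lambda>y. q y * f y) x / q x"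

text \<open>
  For a density \<open>u = q v\<close>, \<open>doob_integrand L q v f\<close> is \<open>u L\<^sup>q f\<close>, whose integral is the value of
  the distribution \<open>(L\<^sup>q)\<^sup>* u\<close> at the test function \<open>f\<close>.  Where \<open>q = 0\<close> the factor \<open>q\<close> of \<open>u\<close>
  cancels the factor \<open>1/q\<close> of \<open>L\<^sup>q\<close>, and \<open>u L\<^sup>q f\<close> means \<open>v L(q f)\<close>; this part does not vanish,
  because the process may jump out of the zero set of \<open>q\<close>.
\<close>

definition doob_integrand ::
    "((real^'n \<Rightarrow> real) \<Rightarrow> real^'n \<Rightarrow> real) \<Rightarrow> (real^'n \<Rightarrow> real) \<Rightarrow> (real^'n \<Rightarrow> real) \<Rightarrow>
     (real^'n \<Rightarrow> real) \<Rightarrow> real^'n \<Rightarrow> real" where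
  "doob_integrand L q v f x =
     (if q x \<noteq> 0 then (q x * v x) * doob_transform L q f x else v x * L (\<lambda>y. q y * f y) x)"

lemma doob_integrand_eq: "doob_integrand L q v f x = v x * L (\<lambda>y. q y * f y) x"
  by (simp add: doob_integrand_def doob_transform_def)

text \<open>\<open>(L\<^sup>q)\<^sup>* (q v) = - \<nabla> \<cdot> J\<close> on \<open>S\<close>, in the sense of distributions.\<close>

definition forward_divergence_form ::
    "((real^'n \<Rightarrow> real) \<Rightarrow> real^'n \<Rightarrow> real) \<Rightarrow> (real^'n \<Rightarrow> real) \<Rightarrow> (real^'n) set \<Rightarrow>
     (real^'n \<Rightarrow> real) \<Rightarrow> (real^'n \<Rightarrow> real^'n) \<Rightarrow> bool" where
  "forward_divergence_form L q S v J \<longleftrightarrow>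
     locally_integrable_on S J \<and>
     (\<forall>f\<in>C2c S. integrable lborel (doob_integrand L q v f) \<and>
        (LINT x|lborel. doob_integrand L q v f x) = (LINT x:S|lborel. J x \<bullet> grad f x))"

text \<open>\<open>(L\<^sup>q)\<^sup>* (q v) = 0\<close> on \<open>S\<close>.\<close>

definition forward_stationary ::
    "((real^'n \<Rightarrow> real) \<Rightarrow> real^'n \<Rightarrow> real) \<Rightarrow> (real^'n \<Rightarrow> real) \<Rightarrow> (real^'n) set \<Rightarrow>
     (real^'n \<Rightarrow> real) \<Rightarrow> bool" where
  "forward_stationary L q S v \<longleftrightarrow>
     (\<forall>f\<in>C2c S. integrable lborel (doob_integrand L q v f) \<and>
        (LINT x|lborel. doob_integrand L q v f x) = 0)"

definition divergence_free :: "(real^'n) set \<Rightarrow> (real^'n \<Rightarrow> real^'n) \<Rightarrow> bool" where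
  "divergence_free S J \<longleftrightarrow>
     locally_integrable_on S J \<and> (\<forall>f\<in>C2c S. (LINT x:S|lborel. J x \<bullet> grad f x) = 0)"

text \<open>
  The current is the flux \<open>J\<close> in the divergence form of the forward operator
  \<open>(L\<^sup>q)\<^sup>* (\<rho> q g) = - \<nabla> \<cdot> J[g]\<close>, taken at the stationary density \<open>\<rho> q g\<^sub>0\<close>.  The identity is
  required for all \<open>g\<close> in the class \<open>\<G>\<close>, not only for \<open>g\<^sub>0\<close>: at \<open>g\<^sub>0\<close> alone both sides are \<open>0\<close>,
  and even the zero field would qualify.
\<close>

definition is_probability_current ::
    "((real^'n \<Rightarrow> real) \<Rightarrow> real^'n \<Rightarrow> real) \<Rightarrow> (real^'n \<Rightarrow> real) \<Rightarrow> (real^'n \<Rightarrow> real) \<Rightarrow>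
     (real^'n) set \<Rightarrow> (real^'n \<Rightarrow> real) set \<Rightarrow> (real^'n \<Rightarrow> real) \<Rightarrow>
     ((real^'n \<Rightarrow> real) \<Rightarrow> real^'n \<Rightarrow> real^'n) \<Rightarrow> bool" where
  "is_probability_current L \<rho> q S \<G> g\<^sub>0 J \<longleftrightarrow>
     g\<^sub>0 \<in> \<G> \<and>
     (\<forall>g\<in>\<G>. forward_divergence_form L q S (\<lambda>x. \<rho> x * g x) (J g)) \<and>
     forward_stationary L q S (\<lambda>x. \<rho> x * g\<^sub>0 x) \<and>
     divergence_free S (J g\<^sub>0)"


section \<open>Fluxes of the jump part\<close>

definition jump_map ::
    "(real^'n \<Rightarrow> real^'m \<Rightarrow> real^'n) \<Rightarrow> real \<Rightarrow> real^'m \<Rightarrow> real^'n \<Rightarrow> real^'n" where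
  "jump_map F \<theta> r x = x + \<theta> *\<^sub>R F x r"

definition jump_inv ::
    "(real^'n \<Rightarrow> real^'m \<Rightarrow> real^'n) \<Rightarrow> real \<Rightarrow> real^'m \<Rightarrow> real^'n \<Rightarrow> real^'n" where
  "jump_inv F \<theta> r = inv (jump_map F \<theta> r)"

definition jump_jacobian ::
    "(real^'n \<Rightarrow> real^'m \<Rightarrow> real^'n) \<Rightarrow> real \<Rightarrow> real^'m \<Rightarrow> real^'n \<Rightarrow> real" where
  "jump_jacobian F \<theta> r x = \<bar>det (matrix (frechet_derivative (jump_inv F \<theta> r) (at x)))\<bar>"

text \<open>The inverse of a Borel bijection is Borel (Lusin--Souslin), so the measurability clause
  is only a convenience.\<close>

definition regular_jump_maps :: "(real^'n \<Rightarrow> real^'m \<Rightarrow> real^'n) \<Rightarrow> bool" where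
  "regular_jump_maps F \<longleftrightarrow>
     (\<forall>\<theta>\<in>{0..1}. \<forall>r\<in>ball 0 1. bij (jump_map F \<theta> r) \<and>
        (\<forall>x. jump_inv F \<theta> r differentiable (at x))) \<and>
     (\<lambda>(x, r, \<theta>). jump_inv F \<theta> r x)
       \<in> borel_measurable (restrict_space borel (UNIV \<times> ball 0 1 \<times> {0..1}))"

definition compensator_drift ::
    "(real^'n \<Rightarrow> real^'m \<Rightarrow> real^'n) \<Rightarrow> (real^'m) measure \<Rightarrow> real^'n \<Rightarrow> real^'n" where
  "compensator_drift F \<nu> x = (LINT r:ball 0 1|\<nu>. F x r)"

definition jump_flux ::
    "(real^'n \<Rightarrow> real^'m \<Rightarrow> real^'n) \<Rightarrow> (real^'m) measure \<Rightarrow>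
     (real^'n \<Rightarrow> real^'m \<Rightarrow> real^'n) \<Rightarrow> real^'n \<Rightarrow> real^'n" where
  "jump_flux F \<nu> G x =
     (LINT r:ball 0 1|\<nu>. (LINT \<theta>:{0..1}|lborel.
        jump_jacobian F \<theta> r x *\<^sub>R G (jump_inv F \<theta> r x) r))"

text \<open>
  The stationary equation
  \<open>-\<nabla>\<cdot>[(b - \<integral>F d\<nu>) \<rho>] + 1/2 \<Sum> \<partial>\<^sub>i\<^sub>j (\<Sigma>\<^sub>i\<^sub>j \<rho>) - \<nabla>\<cdot>(jump flux) = 0\<close> in the sense of distributions, together
  with the local integrability that gives its terms a meaning.
\<close>

definition stationary_forward_equation ::
    "(real^'n \<Rightarrow> real^'n) \<Rightarrow> (real^'n \<Rightarrow> real^'n^'n) \<Rightarrow> (real^'n \<Rightarrow> real^'m \<Rightarrow> real^'n) \<Rightarrow>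
     (real^'m) measure \<Rightarrow> (real^'n \<Rightarrow> real) \<Rightarrow> bool" where
  "stationary_forward_equation b \<sigma> F \<nu> \<rho> \<longleftrightarrow>
     (\<forall>x. set_integrable \<nu> (ball 0 1) (F x)) \<and>
     locally_integrable_on UNIV (\<lambda>x. \<rho> x *\<^sub>R (b x - compensator_drift F \<nu> x)) \<and>
     locally_integrable_on UNIV (\<lambda>x. \<rho> x *\<^sub>R diffusion_matrix \<sigma> x) \<and>
     (\<forall>K. compact K \<longrightarrow>
        (\<integral>\<^sup>+ x\<in>K. (\<integral>\<^sup>+ r\<in>ball 0 1. (\<integral>\<^sup>+ \<theta>\<in>{0..1}.
           ennreal (\<rho> (jump_inv F \<theta> r x) * norm (F (jump_inv F \<theta> r x) r) * jump_jacobian F \<theta> r x)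
           \<partial>lborel) \<partial>\<nu>) \<partial>lborel) < \<infinity>) \<and>
     (\<forall>f\<in>C2c UNIV.
        (LINT x|lborel. \<rho> x * ((b x - compensator_drift F \<nu> x) \<bullet> grad f x)
           + 1/2 * (\<Sum>i\<in>UNIV. \<Sum>j\<in>UNIV.
               diffusion_matrix \<sigma> x $ i $ j * \<rho> x * partial i (partial j f) x)
           + jump_flux F \<nu> (\<lambda>y r. \<rho> y *\<^sub>R F y r) x \<bullet> grad f x) = 0)"

text \<open>The \<open>g\<close> for which the divergence of the matrix field \<open>\<Sigma> \<rho> q g\<close> exists classically on \<open>S\<close>.\<close>

definition admissible_factors ::
    "(real^'n \<Rightarrow> real^'n^'n) \<Rightarrow> (real^'n \<Rightarrow> real) \<Rightarrow> (real^'n \<Rightarrow> real) \<Rightarrow> (real^'n) set \<Rightarrow>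
     (real^'n \<Rightarrow> real) set" where
  "admissible_factors \<sigma> \<rho> q S =
     {g. g \<in> borel_measurable borel \<and> bounded (range g) \<and>
         (\<forall>i j. Ck_on 1 S (\<lambda>x. diffusion_matrix \<sigma> x $ i $ j * (\<rho> x * q x * g x)))}"

text \<open>
  The diffusive part carries the sign \<open>-1/2\<close>: the forward operator contains
  \<open>+1/2 \<Sum> \<partial>\<^sub>i\<^sub>j (\<Sigma>\<^sub>i\<^sub>j u) = -\<nabla>\<cdot>(-1/2 div (\<Sigma> u))\<close>.  With \<open>+1/2\<close> the field would not be divergence free, already
  for a one-dimensional diffusion without jumps.
\<close>

definition transition_current ::
    "(real^'n \<Rightarrow> real^'n) \<Rightarrow> (real^'n \<Rightarrow> real^'n^'n) \<Rightarrow> (real^'n \<Rightarrow> real^'m \<Rightarrow> real^'n) \<Rightarrow>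
     (real^'m) measure \<Rightarrow> (real^'n \<Rightarrow> real) \<Rightarrow> (real^'n \<Rightarrow> real) \<Rightarrow> (real^'n \<Rightarrow> real) \<Rightarrow>
     real^'n \<Rightarrow> real^'n" where
  "transition_current b \<sigma> F \<nu> \<rho> q g x =
     (\<rho> x * q x * g x) *\<^sub>R
       (b x + diffusion_matrix \<sigma> x *v (grad q x /\<^sub>R q x) - compensator_drift F \<nu> x)
     + jump_flux F \<nu> (\<lambda>y r. (q (y + F y r) * \<rho> y * g y) *\<^sub>R F y r) x
     - (1/2) *\<^sub>R matrix_div (\<lambda>y. (\<rho> y * q y * g y) *\<^sub>R diffusion_matrix \<sigma> y) x"

end

theory Submission
  imports Defs
begin

text \<open>
  For a test function \<open>f\<close> supported in \<open>\<Theta>\<close>, the product rule and \<open>L q = 0\<close> give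
  \<open>L (q f) = q (b - \<integral>F d\<nu>) \<cdot> \<nabla>f + \<Sigma>\<nabla>q \<cdot> \<nabla>f + 1/2 q \<Sum> \<Sigma>\<^sub>i\<^sub>j \<partial>\<^sub>i\<^sub>j f + \<integral> q(x + F) (f(x + F) - f(x)) d\<nu>\<close>
  on the whole space.  Integrated against \<open>\<rho> g\<close>, the first two terms are the drift part of the
  current tested against \<open>\<nabla>f\<close>, and the third one becomes the divergence term after one integration by
  parts.  In the last one, \<open>f(x + F) - f(x)\<close> is the integral of \<open>F \<cdot> \<nabla>f(x + \<theta> F)\<close> over \<open>\<theta> \<in> [0,1]\<close>;
  Fubini and the substitution \<open>y = x + \<theta> F(x, r)\<close> for fixed \<open>\<theta>\<close> and \<open>r\<close> turn it into the jump flux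
  tested against \<open>\<nabla>f\<close>, the integrability being the one assumed for the stationary equation of \<open>\<rho>\<close>.
  Stationarity is the equation of the backward committor with the test function \<open>q f\<close>.
\<close>

section \<open>Partial derivatives and classes of differentiable functions\<close>

lemma partial_eq_has_derivative:
  assumes "(f has_derivative D) (at x)"
  shows "partial i f x = D (axis i 1)"
proof -
  have "((\<lambda>t. x + t *\<^sub>R axis i 1) has_derivative (\<lambda>t. t *\<^sub>R axis i 1)) (at (0::real))"
    by (auto intro!: derivative_eq_intros)
  moreover have "(f has_derivative D) (at (x + 0 *\<^sub>R axis i 1))"
    using assms by simp
  ultimately have "((\<lambda>t. f (x + t *\<^sub>R axis i 1)) has_derivative (\<lambda>t. D (t *\<^sub>R axis i 1))) (at 0)"
    using has_derivative_compose by blast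
  moreover have "(\<lambda>t. D (t *\<^sub>R axis i 1)) = (\<lambda>t. t * D (axis i 1))"
    using assms by (auto simp: has_derivative_def bounded_linear.linear linear_scale)
  ultimately have "((\<lambda>t. f (x + t *\<^sub>R axis i 1)) has_field_derivative D (axis i 1)) (at 0)"
    by (auto intro: has_derivative_imp_has_field_derivative)
  then show ?thesis
    unfolding partial_def by (rule DERIV_imp_deriv)
qed

text \<open>A linear map is determined by its values on the axis vectors, and for the derivative
  these are the one-dimensional derivatives that make up \<open>grad\<close>.\<close>

lemma has_derivative_grad:
  fixes f :: "real^'n \<Rightarrow> real"
  assumes "f differentiable (at x)"
  shows "(f has_derivative (\<lambda>h. h \<bullet> grad f x)) (at x)"
proof -
  obtain D where D: "(f has_derivative D) (at x)"
    using assms by (auto simp: differentiable_def)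
  then have lin: "linear D"
    by (simp add: has_derivative_linear)
  have "D h = h \<bullet> grad f x" for h
  proof -
    have "D h = D (\<Sum>i\<in>UNIV. h $ i *\<^sub>R axis i 1)"
      by (metis basis_expansion scalar_mult_eq_scaleR)
    also have "\<dots> = (\<Sum>i\<in>UNIV. h $ i * D (axis i 1))"
      using lin by (simp add: linear_sum linear_scale)
    also have "\<dots> = h \<bullet> grad f x"
      by (simp add: inner_vec_def grad_def partial_eq_has_derivative[OF D])
    finally show ?thesis .
  qed
  then show ?thesis
    using D by presburger
qed

text \<open>\<open>deriv\<close> at 0 sees only values near 0, and a short piece of the line through
  \<open>x\<close> stays inside \<open>S\<close>.\<close>

lemma partial_cong_open:
  assumes "open S" "x \<in> S" "\<And>y. y \<in> S \<Longrightarrow> f y = g y"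
  shows "partial i f x = partial i g x"
proof -
  have "((\<lambda>t. x + t *\<^sub>R axis i 1) \<longlongrightarrow> x + 0 *\<^sub>R axis i 1) (nhds (0::real))"
    by (intro tendsto_intros filterlim_ident)
  then have "eventually (\<lambda>t. x + t *\<^sub>R axis i 1 \<in> S) (nhds (0::real))"
    using assms(1,2) by (auto elim!: topological_tendstoD)
  then have "eventually (\<lambda>t. f (x + t *\<^sub>R axis i 1) = g (x + t *\<^sub>R axis i 1)) (nhds (0::real))"
    by eventually_elim (simp add: assms(3))
  then show ?thesis
    unfolding partial_def by (rule deriv_cong_ev) simp
qed

lemma partial_const [simp]: "partial i (\<lambda>_. c) x = 0"
  by (simp add: partial_def)

lemma partial_mult:
  assumes "f differentiable (at x)" "g differentiable (at x)"
  shows "partial i (\<lambda>y. f y * g y) x = partial i f x * g x + f x * partial i g x"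
proof -
  obtain f' g' where d: "(f has_derivative f') (at x)" "(g has_derivative g') (at x)"
    using assms unfolding differentiable_def by blast
  show ?thesis
    using partial_eq_has_derivative[OF has_derivative_mult[OF d]]
    by (simp add: partial_eq_has_derivative[OF d(1)] partial_eq_has_derivative[OF d(2)])
qed

lemma partial_add:
  assumes "f differentiable (at x)" "g differentiable (at x)"
  shows "partial i (\<lambda>y. f y + g y) x = partial i f x + partial i g x"
proof -
  obtain f' g' where d: "(f has_derivative f') (at x)" "(g has_derivative g') (at x)"
    using assms unfolding differentiable_def by blast
  show ?thesis
    using partial_eq_has_derivative[OF has_derivative_add[OF d]]
    by (simp add: partial_eq_has_derivative[OF d(1)] partial_eq_has_derivative[OF d(2)])
qed

lemma grad_mult:
  assumes "f differentiable (at x)" "g differentiable (at x)"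
  shows "grad (\<lambda>y. f y * g y) x = g x *\<^sub>R grad f x + f x *\<^sub>R grad g x"
  by (simp add: grad_def vec_eq_iff partial_mult[OF assms])

section \<open>Closure properties of \<open>Ck_on\<close> and products with test functions\<close>

lemma Ck_on_const: "Ck_on k S (\<lambda>_. c)"
proof (induction k arbitrary: c)
  case (Suc k)
  have "partial i (\<lambda>_. c) = (\<lambda>_. 0)" for i :: 'a
    by auto
  then show ?case
    using Suc by simp
qed simp

text \<open>The sum and product rules identify partial derivatives only at points of
  \<open>S\<close>, so \<open>Ck_on\<close> has to be insensitive to values outside
  \<open>S\<close>. Openness carries the agreement over to all derivatives.\<close>

lemma Ck_on_cong:
  assumes "open S" "\<And>x. x \<in> S \<Longrightarrow> f x = g x" "Ck_on k S f"
  shows "Ck_on k S g"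
  using assms(2,3)
proof (induction k arbitrary: f g)
  case 0
  then show ?case
    by (metis Ck_on.simps(1) continuous_on_cong)
next
  case (Suc k)
  have "g differentiable (at x)" if "x \<in> S" for x
    using Suc.prems that has_derivative_transform_within_open[OF _ assms(1) that, of f _ UNIV g]
    unfolding Ck_on.simps differentiable_def by blast
  moreover have "Ck_on k S (partial i g)" for i
    using Suc.IH[of "partial i f" "partial i g"] Suc.prems partial_cong_open[OF assms(1)]
    by (metis Ck_on.simps(2))
  ultimately show ?case
    by simp
qed

lemma Ck_on_Suc_continuous_on: "Ck_on (Suc k) S f \<Longrightarrow> continuous_on S f"
  by (auto intro!: continuous_at_imp_continuous_on differentiable_imp_continuous_within)

lemma Ck_on_Suc_imp: "Ck_on (Suc k) S f \<Longrightarrow> Ck_on k S f"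
proof (induction k arbitrary: f)
  case 0
  then show ?case
    using Ck_on_Suc_continuous_on by (metis Ck_on.simps(1))
next
  case (Suc k)
  then show ?case
    by (metis Ck_on.simps(2))
qed

lemma Ck_on_add:
  assumes "open S" "Ck_on k S f" "Ck_on k S g"
  shows "Ck_on k S (\<lambda>x. f x + g x)"
  using assms(2,3)
proof (induction k arbitrary: f g)
  case 0
  then show ?case
    by (simp add: continuous_on_add)
next
  case (Suc k)
  have "Ck_on k S (partial i (\<lambda>x. f x + g x))" for i
  proof (rule Ck_on_cong[OF assms(1)])
    show "Ck_on k S (\<lambda>x. partial i f x + partial i g x)"
      using Suc.prems by (intro Suc.IH) auto
    show "partial i f x + partial i g x = partial i (\<lambda>x. f x + g x) x" if "x \<in> S" for x
      using Suc.prems that partial_add[of f x g i] by auto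
  qed
  then show ?case
    using Suc.prems by simp
qed

lemma Ck_on_mult:
  assumes "open S" "Ck_on k S f" "Ck_on k S g"
  shows "Ck_on k S (\<lambda>x. f x * g x)"
  using assms(2,3)
proof (induction k arbitrary: f g)
  case 0
  then show ?case
    by (simp add: continuous_on_mult)
next
  case (Suc k)
  have f: "Ck_on k S f" and g: "Ck_on k S g"
    using Suc.prems Ck_on_Suc_imp by blast+
  have "Ck_on k S (partial i (\<lambda>x. f x * g x))" for i
  proof (rule Ck_on_cong[OF assms(1)])
    show "Ck_on k S (\<lambda>x. partial i f x * g x + f x * partial i g x)"
      using Suc.prems f g by (intro Ck_on_add[OF assms(1)] Suc.IH) auto
    show "partial i f x * g x + f x * partial i g x = partial i (\<lambda>x. f x * g x) x" if "x \<in> S" for x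
      using Suc.prems that partial_mult[of f x g i] by auto
  qed
  then show ?case
    using Suc.prems by simp
qed

lemma Ck_on_Un:
  assumes "open S" "open T" "Ck_on k S f" "Ck_on k T f"
  shows "Ck_on k (S \<union> T) f"
  using assms(3,4)
proof (induction k arbitrary: f)
  case 0
  then show ?case
    by (simp add: assms continuous_on_open_Un)
qed auto

lemma Ck_on_subset: "Ck_on k T f \<Longrightarrow> S \<subseteq> T \<Longrightarrow> Ck_on k S f"
  by (induction k arbitrary: f) (auto intro: continuous_on_subset)

text \<open>\<open>S\<close> and the complement of the support form an open cover of the space, and
  \<open>f\<close> is constantly 0 on the second set.\<close>

lemma Ck_on_UNIV_if_support:
  assumes "open S" "Ck_on k S f" "closure {x. f x \<noteq> 0} \<subseteq> S"
  shows "Ck_on k UNIV f"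
proof -
  have "Ck_on k (- closure {x. f x \<noteq> 0}) f"
  proof (rule Ck_on_cong)
    show "0 = f x" if "x \<in> - closure {x. f x \<noteq> 0}" for x
      using that closure_subset[of "{x. f x \<noteq> 0}"] by auto
  qed (use Ck_on_const in auto)
  with assms have "Ck_on k (S \<union> - closure {x. f x \<noteq> 0}) f"
    by (intro Ck_on_Un) auto
  moreover have "S \<union> - closure {x. f x \<noteq> 0} = UNIV"
    using assms(3) by auto
  ultimately show ?thesis
    by simp
qed

text \<open>This makes \<open>q f\<close> a legitimate test function for the backward committor
  equation although \<open>q\<close> is known to be twice differentiable only on \<open>S\<close>:
  the support of \<open>f\<close> hides the rest.\<close>

lemma C2c_mult:
  assumes "open S" "Ck_on 2 S q" "f \<in> C2c S"
  shows "(\<lambda>x. q x * f x) \<in> C2c S"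
proof -
  have f: "Ck_on 2 UNIV f" "compact (closure {x. f x \<noteq> 0})" "closure {x. f x \<noteq> 0} \<subseteq> S"
    using assms(3) by (auto simp: C2c_def)
  have sub: "closure {x. q x * f x \<noteq> 0} \<subseteq> closure {x. f x \<noteq> 0}"
    by (intro closure_mono) auto
  have "Ck_on 2 S f"
    using f(1) by (rule Ck_on_subset) simp
  with assms have "Ck_on 2 S (\<lambda>x. q x * f x)"
    by (intro Ck_on_mult)
  then have "Ck_on 2 UNIV (\<lambda>x. q x * f x)"
    using sub f(3) by (intro Ck_on_UNIV_if_support[OF assms(1)]) auto
  moreover have "compact (closure {x. q x * f x \<noteq> 0})"
    using closed_Int_compact[OF closed_closure f(2), of "{x. q x * f x \<noteq> 0}"] sub
    by (simp add: Int_absorb2)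
  ultimately show ?thesis
    using sub f(3) unfolding C2c_def by blast
qed

section \<open>Derivatives off the support and integration along segments\<close>

lemma partial_support:
  assumes "x \<notin> closure {x. f x \<noteq> 0}"
  shows "partial i f x = 0"
proof -
  have "partial i f x = partial i (\<lambda>_. 0) x"
    using assms closure_subset[of "{x. f x \<noteq> 0}"]
    by (intro partial_cong_open[of "- closure {x. f x \<noteq> 0}"]) auto
  then show ?thesis
    by simp
qed

lemma closure_support_partial: "closure {x. partial i f x \<noteq> 0} \<subseteq> closure {x. f x \<noteq> 0}"
  by (rule closure_minimal) (use partial_support in blast)+

lemma grad_support:
  assumes "x \<notin> closure {x. f x \<noteq> 0}"
  shows "grad f x = 0"
  by (simp add: grad_def vec_eq_iff partial_support[OF assms])

lemma Ck_on_imp_continuous_on: "Ck_on k S f \<Longrightarrow> continuous_on S f"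
  using Ck_on_Suc_continuous_on by (cases k) auto

lemma Ck_on_Suc_continuous_on_grad: "Ck_on (Suc k) S f \<Longrightarrow> continuous_on S (grad f)"
  unfolding grad_def
  by (intro continuous_intros) (simp add: Ck_on_imp_continuous_on[of k])

text \<open>The chain rule on the segment, followed by the fundamental theorem of calculus. With
  \<open>v\<close> a jump it produces the \<theta>-integral of the current; with \<open>v\<close> an
  axis vector it gives integration by parts.\<close>

lemma integral_grad_segment:
  fixes f :: "real^'n \<Rightarrow> real"
  assumes "Ck_on (Suc k) UNIV f"
  shows "(LINT t:{0..1}|lborel. v \<bullet> grad f (x + t *\<^sub>R v)) = f (x + v) - f x"
proof -
  have diff: "f differentiable (at y)" for y
    using assms by simp
  have "((\<lambda>t. f (x + t *\<^sub>R v)) has_real_derivative v \<bullet> grad f (x + t *\<^sub>R v)) (at t)" for t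
  proof -
    have "((\<lambda>t. x + t *\<^sub>R v) has_derivative (\<lambda>t. t *\<^sub>R v)) (at t)"
      by (auto intro!: derivative_eq_intros)
    from has_derivative_compose[OF this has_derivative_grad[OF diff]]
    show ?thesis
      by (rule has_derivative_imp_has_field_derivative) simp
  qed
  moreover have "continuous_on UNIV (\<lambda>t. v \<bullet> grad f (x + t *\<^sub>R v))"
    by (intro continuous_intros continuous_on_compose2[OF Ck_on_Suc_continuous_on_grad[OF assms]]) simp
  ultimately have "(\<integral>t. (v \<bullet> grad f (x + t *\<^sub>R v)) * indicator {0..1} t \<partial>lborel) = f (x + 1 *\<^sub>R v) - f (x + 0 *\<^sub>R v)"
    by (intro integral_FTC_Icc_real) (simp_all add: continuous_on_eq_continuous_at)
  then show ?thesis
    by (simp add: set_lebesgue_integral_def mult.commute)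
qed

section \<open>Integrals of derivatives, iterated integrals and changes of variables\<close>

text \<open>Averaging over translations replaces a coordinatewise argument. The integral of
  \<open>u (t e + x)\<close> over \<open>x\<close> does not depend on \<open>t\<close>, so averaging
  it over \<open>t\<close> in \<open>{0..1}\<close> changes nothing. Integrated over
  \<open>t\<close> first, it becomes \<open>w (e + x) - w x\<close>, whose integral vanishes by
  translation invariance.\<close>

lemma integral_partial_eq_0:
  fixes w :: "real^'n \<Rightarrow> real"
  assumes w: "Ck_on 1 UNIV w" and supp: "compact (closure {x. w x \<noteq> 0})"
  shows "integrable lborel (partial i w)" "(LINT x|lborel. partial i w x) = 0"
proof -
  define u where "u = partial i w"
  let ?e = "axis i 1 :: real^'n"
  have cont: "continuous_on UNIV u" and wcont: "continuous_on UNIV w"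
    using w Ck_on_Suc_continuous_on[of 0 UNIV w] by (simp_all add: u_def)
  then have [measurable]: "u \<in> borel_measurable borel" "w \<in> borel_measurable borel"
    by (auto intro: borel_measurable_continuous_onI)
  have int_w: "integrable lborel w"
  proof -
    have eq: "(\<lambda>x. indicator (closure {x. w x \<noteq> 0}) x *\<^sub>R w x) = w"
      using closure_subset[of "{x. w x \<noteq> 0}"] by (auto simp: indicator_def fun_eq_iff)
    show ?thesis
      using borel_integrable_compact[OF supp continuous_on_subset[OF wcont subset_UNIV]] unfolding eq .
  qed
  have int_u: "integrable lborel u"
  proof -
    have eq: "(\<lambda>x. indicator (closure {x. w x \<noteq> 0}) x *\<^sub>R u x) = u"
      using partial_support[of _ w i] by (auto simp: indicator_def u_def fun_eq_iff)
    show ?thesis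
      using borel_integrable_compact[OF supp continuous_on_subset[OF cont subset_UNIV]] unfolding eq .
  qed
  then show "integrable lborel (partial i w)"
    by (simp add: u_def)
  have shift: "(\<integral>x. h (c + x) \<partial>lborel) = (\<integral>x. h x \<partial>lborel)"
    "integrable lborel (\<lambda>x. h (c + x)) \<longleftrightarrow> integrable lborel h"
    if [measurable]: "h \<in> borel_measurable borel" for h :: "real^'n \<Rightarrow> real" and c
    using integral_distr[of "(+) c" lborel borel h] integrable_distr_eq[of "(+) c" lborel borel h]
    by (simp_all add: lborel_distr_plus)
  define H where "H = (\<lambda>t x. indicator {0..1::real} t * u (t *\<^sub>R ?e + x))"
  have "integrable (lborel \<Otimes>\<^sub>M lborel) (case_prod H)"
  proof (rule lborel_pair.Fubini_integrable)
    show "case_prod H \<in> borel_measurable (lborel \<Otimes>\<^sub>M lborel)"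
      unfolding H_def by measurable
    have "(\<integral>x. norm (H t x) \<partial>lborel) = indicator {0..1} t * (\<integral>x. \<bar>u x\<bar> \<partial>lborel)" for t
      using shift(1)[of "\<lambda>x. \<bar>u x\<bar>"] by (simp add: H_def abs_mult)
    then show "integrable lborel (\<lambda>t. \<integral>x. norm (case_prod H (t, x)) \<partial>lborel)"
      by simp
    show "AE t in lborel. integrable lborel (\<lambda>x. case_prod H (t, x))"
      using shift(2)[of u] int_u by (simp add: H_def)
  qed
  then have "(\<integral>x. (\<integral>t. H t x \<partial>lborel) \<partial>lborel) = (\<integral>t. (\<integral>x. H t x \<partial>lborel) \<partial>lborel)"
    by (rule lborel_pair.Fubini_integral)
  moreover have "(\<integral>x. H t x \<partial>lborel) = indicator {0..1} t * (\<integral>x. u x \<partial>lborel)" for t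
    using shift(1)[of u] by (simp add: H_def)
  moreover have "(\<integral>t. H t x \<partial>lborel) = w (?e + x) - w x" for x
  proof -
    have "H t x = indicator {0..1} t *\<^sub>R (?e \<bullet> grad w (x + t *\<^sub>R ?e))" for t
      by (simp add: H_def u_def grad_def inner_axis' add.commute)
    then show ?thesis
      using integral_grad_segment[of 0 w ?e x] w by (simp add: set_lebesgue_integral_def add.commute)
  qed
  moreover have "(\<integral>x. w (?e + x) - w x \<partial>lborel) = 0"
    using shift[of w] int_w by simp
  ultimately show "(LINT x|lborel. partial i w x) = 0"
    by (simp add: u_def)
qed

text \<open>Fubini twice. The inner double integral is known to agree with the integral over
  \<open>R \<Otimes>\<^sub>M T\<close> where the section of \<open>H\<close> is integrable, that is
  for almost every \<open>x\<close>; both claims therefore pass through an almost-everywhere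
  identity.\<close>

lemma integral_iterated_pair:
  fixes H :: "'a \<times> 'b \<times> 'c \<Rightarrow> 'd::{banach, second_countable_topology}"
  assumes "sigma_finite_measure L" "sigma_finite_measure R" "sigma_finite_measure T"
    and H: "integrable (L \<Otimes>\<^sub>M (R \<Otimes>\<^sub>M T)) H"
  shows "integrable L (\<lambda>x. \<integral>r. (\<integral>t. H (x, r, t) \<partial>T) \<partial>R)"
    and "(\<integral>x. (\<integral>r. (\<integral>t. H (x, r, t) \<partial>T) \<partial>R) \<partial>L) = integral\<^sup>L (L \<Otimes>\<^sub>M (R \<Otimes>\<^sub>M T)) H"
proof -
  interpret RT: pair_sigma_finite R T
    using assms by (simp add: pair_sigma_finite_def)
  interpret LRT: pair_sigma_finite L "R \<Otimes>\<^sub>M T"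
    using assms RT.sigma_finite_measure_axioms by (simp add: pair_sigma_finite_def)
  note [measurable] = borel_measurable_integrable[OF H]
  have AE: "AE x in L. (\<integral>r. (\<integral>t. H (x, r, t) \<partial>T) \<partial>R) = (\<integral>y. H (x, y) \<partial>(R \<Otimes>\<^sub>M T))"
    using LRT.AE_integrable_fst'[OF H]
  proof eventually_elim
    case (elim x)
    then show ?case
      using RT.integral_fst'[OF elim] by simp
  qed
  have [measurable]: "(\<lambda>x. \<integral>r. (\<integral>t. H (x, r, t) \<partial>T) \<partial>R) \<in> borel_measurable L"
    by measurable
  show "integrable L (\<lambda>x. \<integral>r. (\<integral>t. H (x, r, t) \<partial>T) \<partial>R)"
    using LRT.integrable_fst'[OF H] AE by (subst integrable_cong_AE) auto
  have "(\<integral>x. (\<integral>r. (\<integral>t. H (x, r, t) \<partial>T) \<partial>R) \<partial>L) = (\<integral>x. (\<integral>y. H (x, y) \<partial>(R \<Otimes>\<^sub>M T)) \<partial>L)"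
    using AE by (intro integral_cong_AE) auto
  then show "(\<integral>x. (\<integral>r. (\<integral>t. H (x, r, t) \<partial>T) \<partial>R) \<partial>L) = integral\<^sup>L (L \<Otimes>\<^sub>M (R \<Otimes>\<^sub>M T)) H"
    by (simp add: LRT.integral_fst'[OF H])
qed

section \<open>Measurable Jacobians and the change of variables\<close>

lemma borel_measurable_vec_nth [measurable (raw)]:
  fixes f :: "'a \<Rightarrow> 'b::real_normed_vector ^ 'n"
  shows "f \<in> borel_measurable M \<Longrightarrow> (\<lambda>x. f x $ i) \<in> borel_measurable M"
  by (erule measurable_compose[OF _ borel_measurable_continuous_onI]) (intro continuous_intros)

text \<open>The derivative is approached along one fixed sequence of increments, because limits of
  sequences preserve measurability.\<close>

lemma has_derivative_LIMSEQ:
  fixes g :: "real^'n \<Rightarrow> real^'m"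
  assumes "(g has_derivative D) (at x)"
  shows "(\<lambda>n. real (Suc n) * (g (x + inverse (real (Suc n)) *\<^sub>R e) $ i - g x $ i)) \<longlonglongrightarrow> D e $ i"
proof -
  have "((\<lambda>t. x + t *\<^sub>R e) has_derivative (\<lambda>t. t *\<^sub>R e)) (at (0::real))"
    by (auto intro!: derivative_eq_intros)
  moreover have "(g has_derivative D) (at (x + 0 *\<^sub>R e))"
    using assms by simp
  ultimately have "((\<lambda>t. g (x + t *\<^sub>R e)) has_derivative (\<lambda>t. D (t *\<^sub>R e))) (at 0)"
    using has_derivative_compose by blast
  then have "((\<lambda>t. g (x + t *\<^sub>R e) $ i) has_derivative (\<lambda>t. D (t *\<^sub>R e) $ i)) (at 0)"
    by (rule bounded_linear.has_derivative[OF bounded_linear_vec_nth])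
  then have "((\<lambda>t. g (x + t *\<^sub>R e) $ i) has_field_derivative D e $ i) (at 0)"
    by (rule has_derivative_imp_has_field_derivative)
       (use has_derivative_linear[OF assms] in \<open>simp add: linear_scale\<close>)
  then have "((\<lambda>h. (g (x + h *\<^sub>R e) $ i - g x $ i) / h) \<longlongrightarrow> D e $ i) (at 0)"
    by (simp add: DERIV_def)
  then have "(\<lambda>n. (g (x + inverse (real (Suc n)) *\<^sub>R e) $ i - g x $ i) / inverse (real (Suc n))) \<longlonglongrightarrow> D e $ i"
    by (rule filterlim_compose)
       (use LIMSEQ_inverse_real_of_nat in \<open>auto simp: filterlim_at simp del: of_nat_Suc\<close>)
  then show ?thesis
    by (simp add: divide_inverse mult.commute)
qed

text \<open>The matrix entries are limits of difference quotients, and the determinant is a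
  polynomial in the entries. The map varies with \<open>z\<close> because it will be the inverse
  jump map, which depends on \<open>r\<close> and \<theta>; the shifts \<open>c\<close> are the
  increments in the quotients.\<close>

lemma borel_measurable_jacobian:
  fixes g :: "'a \<Rightarrow> real^'n \<Rightarrow> real^'n" and X :: "'a \<Rightarrow> real^'n"
  assumes meas: "\<And>c. (\<lambda>z. g z (X z + c)) \<in> borel_measurable M"
    and diff: "\<And>z. z \<in> space M \<Longrightarrow> g z differentiable (at (X z))"
  shows "(\<lambda>z. det (matrix (frechet_derivative (g z) (at (X z))))) \<in> borel_measurable M"
proof -
  have "(\<lambda>z. frechet_derivative (g z) (at (X z)) e $ i) \<in> borel_measurable M" for e i
  proof (rule borel_measurable_LIMSEQ_real)
    show "(\<lambda>n. real (Suc n) * (g z (X z + inverse (real (Suc n)) *\<^sub>R e) $ i - g z (X z) $ i))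
            \<longlonglongrightarrow> frechet_derivative (g z) (at (X z)) e $ i" if "z \<in> space M" for z
      using diff[OF that] by (intro has_derivative_LIMSEQ) (simp add: frechet_derivative_works[symmetric])
    have [measurable]: "(\<lambda>z. g z (X z)) \<in> borel_measurable M"
      using meas[of 0] by simp
    note meas [measurable]
    show "(\<lambda>z. real (Suc n) * (g z (X z + inverse (real (Suc n)) *\<^sub>R e) $ i - g z (X z) $ i))
            \<in> borel_measurable M" for n
      by measurable
  qed
  then show ?thesis
    unfolding det_def matrix_def by simp
qed

text \<open>Formulating the change of variables for measures makes it available to Bochner and to
  nonnegative integrals alike. It suffices to compare boxes: the Jacobian integrated over the
  preimage of a box is the volume of the image of that preimage, which is the box again since
  \<open>g\<close> is onto.\<close>

lemma lborel_eq_distr_jacobian: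
  fixes g :: "real^'n::{finite,wellorder} \<Rightarrow> real^'n::_"
  assumes bij: "bij g" and diff: "\<And>x. g differentiable (at x)"
  shows "lborel = distr (density lborel (\<lambda>x. ennreal \<bar>det (matrix (frechet_derivative g (at x)))\<bar>)) borel g"
proof (rule lborel_eqI)
  define J where "J = (\<lambda>x. \<bar>det (matrix (frechet_derivative g (at x)))\<bar>)"
  have cont: "continuous_on UNIV g"
    using diff by (simp add: continuous_at_imp_continuous_on differentiable_imp_continuous_within)
  then have [measurable]: "g \<in> borel_measurable borel"
    by (rule borel_measurable_continuous_onI)
  have [measurable]: "J \<in> borel_measurable borel"
    unfolding J_def
    by (intro borel_measurable_abs borel_measurable_jacobian[where X = "\<lambda>x. x" and g = "\<lambda>_. g"]) (use diff in auto)
  fix l u :: "real^'n::_" assume lu: "\<And>b. b \<in> Basis \<Longrightarrow> l \<bullet> b \<le> u \<bullet> b"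
  have S: "g -` box l u \<in> sets borel"
    by (metis borel_open measurable_sets_borel open_box \<open>g \<in> borel_measurable borel\<close>)
  have "g ` (g -` box l u) = box l u"
    using bij by (simp add: bij_is_surj surj_image_vimage_eq)
  then have "g ` (g -` box l u) \<in> lmeasurable \<and> measure lebesgue (g ` (g -` box l u)) = measure lborel (box l u)"
    by simp
  then have "(J has_integral measure lborel (box l u)) (g -` box l u)"
    unfolding J_def
    by (subst has_measure_differentiable_image[symmetric, of _ g])
       (use S bij diff in \<open>auto intro: inj_on_subset[OF bij_is_inj] has_derivative_at_withinI iffD1[OF frechet_derivative_works]\<close>)
  then have "integral\<^sup>N lborel (\<lambda>x. indicator (g -` box l u) x * J x) = measure lborel (box l u)"
    by (intro nn_integral_has_integral_lebesgue) (auto simp: J_def)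
  moreover have "emeasure (distr (density lborel J) borel g) (box l u) = integral\<^sup>N lborel (\<lambda>x. indicator (g -` box l u) x * J x)"
    using S by (simp add: emeasure_distr emeasure_density) (intro nn_integral_cong, simp split: split_indicator)
  moreover have "measure lborel (box l u) = (\<Prod>b\<in>Basis. (u - l) \<bullet> b)"
    using lu by (simp add: measure_lborel_box_eq)
  ultimately show "emeasure (distr (density lborel (\<lambda>x. ennreal \<bar>det (matrix (frechet_derivative g (at x)))\<bar>)) borel g) (box l u)
      = (\<Prod>b\<in>Basis. (u - l) \<bullet> b)"
    by (simp add: J_def)
qed simp

section \<open>The jump part of the current\<close>

text \<open>By Markov's inequality the sets where \<open>min 1 ((norm r)\<^sup>2)\<close> is at
  least \<open>1/(n+1)\<close> have finite measure. They exhaust everything but the origin, which is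
  a null set.\<close>

lemma sigma_finite_levy_measure:
  assumes "levy_measure (\<nu> :: (real^'m) measure)"
  shows "sigma_finite_measure \<nu>"
proof
  have sets [measurable_cong]: "sets \<nu> = sets borel" and zero: "emeasure \<nu> {0} = 0"
    and fin: "(\<integral>\<^sup>+ r. ennreal (min 1 ((norm r)\<^sup>2)) \<partial>\<nu>) < \<infinity>"
    using assms by (auto simp: levy_measure_def)
  have space: "space \<nu> = UNIV"
    using sets_eq_imp_space_eq[OF sets] by simp
  define U where "U = (\<lambda>n::nat. {r :: real^'m. inverse (real (Suc n)) \<le> min 1 ((norm r)\<^sup>2)})"
  have [measurable]: "U n \<in> sets \<nu>" for n
    unfolding U_def by (rule borel_measurable_le[of _ \<nu>, unfolded space, simplified]) measurable
  have "emeasure \<nu> (U n) < \<infinity>" for n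
  proof -
    have "emeasure \<nu> (U n) = (\<integral>\<^sup>+ r. indicator (U n) r \<partial>\<nu>)"
      by simp
    also have "\<dots> \<le> (\<integral>\<^sup>+ r. ennreal (Suc n) * ennreal (min 1 ((norm r)\<^sup>2)) \<partial>\<nu>)"
    proof (intro nn_integral_mono)
      fix r :: "real^'m"
      have "1 \<le> real (Suc n) * min 1 ((norm r)\<^sup>2)" if "r \<in> U n"
        using that mult_left_mono[of "inverse (real (Suc n))" "min 1 ((norm r)\<^sup>2)" "real (Suc n)"]
        by (simp add: U_def del: of_nat_Suc min_less_iff_conj min.bounded_iff)
      then show "indicator (U n) r \<le> ennreal (Suc n) * ennreal (min 1 ((norm r)\<^sup>2))"
        by (auto simp: indicator_def ennreal_mult'[symmetric] simp del: of_nat_Suc)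
    qed
    also have "\<dots> = ennreal (Suc n) * (\<integral>\<^sup>+ r. ennreal (min 1 ((norm r)\<^sup>2)) \<partial>\<nu>)"
      by (intro nn_integral_cmult) measurable
    also have "\<dots> < \<infinity>"
      using fin by (simp add: ennreal_mult_less_top)
    finally show ?thesis .
  qed
  moreover have "r \<in> insert 0 (\<Union>n. U n)" for r
  proof (cases "r = 0")
    case False
    then have "0 < min 1 ((norm r)\<^sup>2)"
      by simp
    from reals_Archimedean[OF this] show ?thesis
      unfolding U_def by (auto intro: less_imp_le)
  qed simp
  ultimately show "\<exists>A. countable A \<and> A \<subseteq> sets \<nu> \<and> \<Union> A = space \<nu> \<and> (\<forall>a\<in>A. emeasure \<nu> a \<noteq> \<infinity>)"
    using zero by (intro exI[of _ "insert {0} (range U)"]) (auto simp: space less_top[symmetric] simp flip: sets)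
qed

text \<open>The weight \<open>G\<close> is left free because two fluxes are compared later: the one
  of \<open>\<rho> F\<close>, controlled by the stationary equation, and the one that also carries
  the committor \<open>q\<close> and the factor \<open>g\<close>.\<close>

locale jump_kernel =
  fixes \<nu> :: "(real^'m) measure" and F G :: "real^'n::{finite,wellorder} \<Rightarrow> real^'m \<Rightarrow> real^'n::_"
  assumes sigma_finite: "sigma_finite_measure \<nu>" and sets_\<nu> [measurable_cong]: "sets \<nu> = sets borel"
    and F_meas: "case_prod F \<in> borel_measurable borel"
    and G_meas: "case_prod G \<in> borel_measurable borel"
    and regular: "regular_jump_maps F"
begin

sublocale \<nu>: sigma_finite_measure \<nu>
  by (rule sigma_finite)

sublocale marks: pair_sigma_finite \<nu> "lborel :: real measure" ..

sublocale prod: pair_sigma_finite "lborel :: (real^'n::_) measure" "\<nu> \<Otimes>\<^sub>M (lborel :: real measure)" ..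

abbreviation "P \<equiv> (lborel :: (real^'n::_) measure) \<Otimes>\<^sub>M (\<nu> \<Otimes>\<^sub>M (lborel :: real measure))"

definition E :: "((real^'n::_) \<times> (real^'m) \<times> real) set" where "E = UNIV \<times> ball 0 1 \<times> {0..1}"

text \<open>Off \<open>E\<close> the jump maps need not be invertible, and \<open>jump_inv\<close>
  is then an arbitrary choice; the indicator discards it.\<close>

definition flux_density :: "(real^'n::_) \<times> (real^'m) \<times> real \<Rightarrow> real^'n::_" where
  "flux_density = (\<lambda>(x, r, \<theta>). indicator E (x, r, \<theta>) *\<^sub>R
     (jump_jacobian F \<theta> r x *\<^sub>R G (jump_inv F \<theta> r x) r))"

lemma E_iff: "(x, r, \<theta>) \<in> E \<longleftrightarrow> norm r < 1 \<and> 0 \<le> \<theta> \<and> \<theta> \<le> 1"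
  by (auto simp: E_def)

lemma sets_P: "sets P = sets (borel :: ((real^'n::_) \<times> (real^'m) \<times> real) measure)"
proof -
  have "sets P = sets (borel \<Otimes>\<^sub>M (borel \<Otimes>\<^sub>M borel))"
    by (intro sets_pair_measure_cong sets_\<nu> sets_lborel refl)
  then show ?thesis
    unfolding borel_prod .
qed

lemma bij_jump_inv: "norm r < 1 \<Longrightarrow> 0 \<le> \<theta> \<Longrightarrow> \<theta> \<le> 1 \<Longrightarrow> bij (jump_inv F \<theta> r)"
  using regular by (auto simp: regular_jump_maps_def jump_inv_def intro!: bij_imp_bij_inv)

lemma jump_inv_add: "norm r < 1 \<Longrightarrow> 0 \<le> \<theta> \<Longrightarrow> \<theta> \<le> 1 \<Longrightarrow>
    jump_inv F \<theta> r x + \<theta> *\<^sub>R F (jump_inv F \<theta> r x) r = x"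
  using regular surj_f_inv_f[of "jump_map F \<theta> r" x]
  unfolding jump_inv_def by (auto simp: regular_jump_maps_def bij_is_surj) (simp add: jump_map_def)

lemma jump_inv_differentiable: "norm r < 1 \<Longrightarrow> 0 \<le> \<theta> \<Longrightarrow> \<theta> \<le> 1 \<Longrightarrow> jump_inv F \<theta> r differentiable (at x)"
  using regular by (auto simp: regular_jump_maps_def)

lemma E_sets: "E \<in> sets borel"
  unfolding E_def by (intro borel_Times) auto

text \<open>Everything is done on the restriction to \<open>E\<close>, where measurability of the
  inverse maps is given. \<open>E\<close> does not restrict \<open>x\<close>, so the shifts needed
  for the difference quotients of the Jacobian stay in \<open>E\<close>.\<close>

lemma flux_density_measurable: "flux_density \<in> borel_measurable borel"
proof -
  let ?R = "restrict_space borel E"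
  have inv: "(\<lambda>(x, r, \<theta>). jump_inv F \<theta> r x) \<in> borel_measurable ?R"
    using regular by (simp add: regular_jump_maps_def E_def)
  have shift: "(\<lambda>(x, r, \<theta>). jump_inv F \<theta> r (x + c)) \<in> borel_measurable ?R" for c
  proof -
    have "(\<lambda>(x, r, \<theta>). (x + c, r, \<theta>)) \<in> ?R \<rightarrow>\<^sub>M ?R"
      by (intro measurable_restrict_space3) (auto simp: E_iff borel_prod[symmetric])
    from measurable_compose[OF this inv] show ?thesis
      by (simp add: case_prod_beta')
  qed
  have "(\<lambda>z. det (matrix (frechet_derivative (jump_inv F (snd (snd z)) (fst (snd z))) (at (fst z))))) \<in> borel_measurable ?R"
    by (intro borel_measurable_jacobian)
       (use shift in \<open>auto simp: case_prod_beta' space_restrict_space E_iff intro!: jump_inv_differentiable\<close>)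
  then have "(\<lambda>(x, r, \<theta>). jump_jacobian F \<theta> r x) \<in> borel_measurable ?R"
    by (simp add: jump_jacobian_def case_prod_beta')
  moreover have "(\<lambda>(x, r, \<theta>). G (jump_inv F \<theta> r x) r) \<in> borel_measurable ?R"
  proof -
    have "(\<lambda>(x, r, \<theta>). r) \<in> borel_measurable ?R"
      by (intro measurable_restrict_space1) (simp add: borel_prod[symmetric])
    with inv have "(\<lambda>z. (jump_inv F (snd (snd z)) (fst (snd z)) (fst z), fst (snd z))) \<in> ?R \<rightarrow>\<^sub>M borel \<Otimes>\<^sub>M borel"
      by (intro measurable_Pair) (simp_all add: case_prod_beta')
    from measurable_compose[OF this, of "case_prod G" borel] G_meas show ?thesis
      by (simp add: borel_prod case_prod_beta')
  qed
  ultimately have "(\<lambda>(x, r, \<theta>). jump_jacobian F \<theta> r x *\<^sub>R G (jump_inv F \<theta> r x) r) \<in> borel_measurable ?R"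
    by (simp add: case_prod_beta')
  then show ?thesis
    by (subst (asm) borel_measurable_restrict_space_iff) (simp_all add: E_sets flux_density_def case_prod_beta')
qed

lemma flux_density_measurable_P [measurable]: "flux_density \<in> borel_measurable P"
  using flux_density_measurable by (subst measurable_cong_sets[OF sets_P refl])

lemma jump_flux_eq: "jump_flux F \<nu> G x = (\<integral>r. (\<integral>\<theta>. flux_density (x, r, \<theta>) \<partial>lborel) \<partial>\<nu>)"
  unfolding jump_flux_def set_lebesgue_integral_def flux_density_def
proof (intro Bochner_Integration.integral_cong refl)
  fix r :: "real^'m"
  show "indicator (ball 0 1) r *\<^sub>R (\<integral>\<theta>. indicator {0..1} \<theta> *\<^sub>R jump_jacobian F \<theta> r x *\<^sub>R G (jump_inv F \<theta> r x) r \<partial>lborel)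
      = (\<integral>\<theta>. (case (x, r, \<theta>) of (x, r, \<theta>) \<Rightarrow> indicator E (x, r, \<theta>) *\<^sub>R
          (jump_jacobian F \<theta> r x *\<^sub>R G (jump_inv F \<theta> r x) r)) \<partial>lborel)"
    by (cases "r \<in> ball 0 1") (auto simp: E_def indicator_def)
qed

text \<open>Tonelli merges the nested integrals, the form in which the stationary equation supplies
  finiteness, into one integral over the product space.\<close>

lemma integrable_flux_densityI:
  assumes "compact K"
    and finite_flux: "(\<integral>\<^sup>+ x\<in>K. (\<integral>\<^sup>+ r\<in>ball 0 1. (\<integral>\<^sup>+ \<theta>\<in>{0..1}.
           ennreal (norm (G (jump_inv F \<theta> r x) r) * jump_jacobian F \<theta> r x)
           \<partial>lborel) \<partial>\<nu>) \<partial>lborel) < \<infinity>"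
  shows "integrable P (\<lambda>z. indicator K (fst z) *\<^sub>R flux_density z)"
proof (rule integrableI_bounded)
  have [measurable]: "K \<in> sets borel"
    using assms by (simp add: borel_compact)
  show meas: "(\<lambda>z. indicator K (fst z) *\<^sub>R flux_density z) \<in> borel_measurable P"
    by measurable
  have "(\<integral>\<^sup>+z. norm (indicator K (fst z) *\<^sub>R flux_density z) \<partial>P)
      = (\<integral>\<^sup>+x. (\<integral>\<^sup>+r. (\<integral>\<^sup>+\<theta>. norm (indicator K x *\<^sub>R flux_density (x, r, \<theta>)) \<partial>lborel) \<partial>\<nu>) \<partial>lborel)"
  proof -
    let ?h = "\<lambda>z. ennreal (norm (indicator K (fst z) *\<^sub>R flux_density z))"
    have "(\<integral>\<^sup>+z. ?h z \<partial>P) = (\<integral>\<^sup>+x. (\<integral>\<^sup>+y. ?h (x, y) \<partial>(\<nu> \<Otimes>\<^sub>M lborel)) \<partial>lborel)"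
      by (rule marks.nn_integral_fst[symmetric]) measurable
    also have "\<dots> = (\<integral>\<^sup>+x. (\<integral>\<^sup>+r. (\<integral>\<^sup>+\<theta>. ?h (x, r, \<theta>) \<partial>lborel) \<partial>\<nu>) \<partial>lborel)"
      by (intro nn_integral_cong lborel.nn_integral_fst[symmetric]) measurable
    finally show ?thesis
      by simp
  qed
  also have "\<dots> = (\<integral>\<^sup>+ x\<in>K. (\<integral>\<^sup>+ r\<in>ball 0 1. (\<integral>\<^sup>+ \<theta>\<in>{0..1}.
           ennreal (norm (G (jump_inv F \<theta> r x) r) * jump_jacobian F \<theta> r x)
           \<partial>lborel) \<partial>\<nu>) \<partial>lborel)"
  proof (rule nn_integral_cong)
    fix x
    have "(\<integral>\<^sup>+r. (\<integral>\<^sup>+\<theta>. norm (indicator K x *\<^sub>R flux_density (x, r, \<theta>)) \<partial>lborel) \<partial>\<nu>) =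
       (\<integral>\<^sup>+ r\<in>ball 0 1. (\<integral>\<^sup>+ \<theta>\<in>{0..1}.
           ennreal (norm (G (jump_inv F \<theta> r x) r) * jump_jacobian F \<theta> r x)
           \<partial>lborel) \<partial>\<nu>)" if "x \<in> K"
    proof (rule nn_integral_cong)
      fix r :: "real^'m"
      show "(\<integral>\<^sup>+\<theta>. norm (indicator K x *\<^sub>R flux_density (x, r, \<theta>)) \<partial>lborel) =
        (\<integral>\<^sup>+ \<theta>\<in>{0..1}. ennreal (norm (G (jump_inv F \<theta> r x) r) * jump_jacobian F \<theta> r x) \<partial>lborel) * indicator (ball 0 1) r"
      proof (cases "r \<in> ball 0 1")
        case True
        with that show ?thesis
          by (auto simp: flux_density_def E_def jump_jacobian_def indicator_def mult.commute intro!: nn_integral_cong)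
      qed (simp add: flux_density_def E_def)
    qed
    then show "(\<integral>\<^sup>+r. (\<integral>\<^sup>+\<theta>. norm (indicator K x *\<^sub>R flux_density (x, r, \<theta>)) \<partial>lborel) \<partial>\<nu>) =
       (\<integral>\<^sup>+ r\<in>ball 0 1. (\<integral>\<^sup>+ \<theta>\<in>{0..1}.
           ennreal (norm (G (jump_inv F \<theta> r x) r) * jump_jacobian F \<theta> r x)
           \<partial>lborel) \<partial>\<nu>) * indicator K x"
      by (cases "x \<in> K") auto
  qed
  also have "\<dots> < \<infinity>"
    by (rule finite_flux)
  finally show "(\<integral>\<^sup>+z. norm (indicator K (fst z) *\<^sub>R flux_density z) \<partial>P) < \<infinity>" .
qed

end

text \<open>The cutoff to \<open>K\<close> acts on the point \<open>x\<close> where the flux is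
  evaluated, not on the starting point \<open>jump_inv F \<theta> r x\<close> of the jump: a
  compactly supported test function localizes only the former.\<close>

locale finite_jump_kernel = jump_kernel \<nu> F G
  for \<nu> :: "(real^'m) measure" and F G :: "real^'n::{finite,wellorder} \<Rightarrow> real^'m \<Rightarrow> real^'n::_" +
  assumes integrable_flux_density:
    "compact K \<Longrightarrow> integrable P (\<lambda>z. indicator K (fst z) *\<^sub>R flux_density z)"
begin

lemma locally_integrable_jump_flux: "locally_integrable_on S (jump_flux F \<nu> G)"
  unfolding locally_integrable_on_def
proof safe
  fix K :: "(real^'n::_) set" assume "compact K"
  from integral_iterated_pair(1)[OF lborel.sigma_finite_measure_axioms sigma_finite
      lborel.sigma_finite_measure_axioms integrable_flux_density[OF this]]
  show "set_integrable lborel K (jump_flux F \<nu> G)"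
    by (simp add: jump_flux_eq set_integrable_def)
qed

text \<open>\<open>\<psi>\<close> is the jump part of the generator applied to a test function with gradient \<open>\<phi>\<close>.\<close>

lemma integral_jump_flux_inner:
  fixes \<phi> :: "real^'n::_ \<Rightarrow> real^'n::_"
  assumes K: "compact K" and \<phi> [measurable]: "\<phi> \<in> borel_measurable borel"
    and bound: "\<And>x. norm (\<phi> x) \<le> C" and supp: "\<And>x. x \<notin> K \<Longrightarrow> \<phi> x = 0"
  defines "\<psi> \<equiv> \<lambda>x. LINT r:ball 0 1|\<nu>. (LINT \<theta>:{0..1}|lborel. G x r \<bullet> \<phi> (x + \<theta> *\<^sub>R F x r))"
  shows "integrable lborel \<psi>" "integrable lborel (\<lambda>x. jump_flux F \<nu> G x \<bullet> \<phi> x)"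
    and "(\<integral>x. \<psi> x \<partial>lborel) = (\<integral>x. jump_flux F \<nu> G x \<bullet> \<phi> x \<partial>lborel)"
proof -
  note [measurable] = F_meas G_meas
  note sf = lborel.sigma_finite_measure_axioms sigma_finite lborel.sigma_finite_measure_axioms
  \<comment> \<open>\<open>\<Phi>\<close> is the pairing seen from the point where the flux is
    evaluated, \<open>\<Psi>\<close> the same pairing seen from the starting point of the
    jump.\<close>
  define \<Phi> where "\<Phi> = (\<lambda>z. flux_density z \<bullet> \<phi> (fst z))"
  define \<Psi> where "\<Psi> = (\<lambda>(x, r, \<theta>). indicator E (x, r, \<theta>) * (G x r \<bullet> \<phi> (x + \<theta> *\<^sub>R F x r)))"
  have \<psi>: "\<psi> x = (\<integral>r. (\<integral>\<theta>. \<Psi> (x, r, \<theta>) \<partial>lborel) \<partial>\<nu>)" for x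
    unfolding \<psi>_def \<Psi>_def set_lebesgue_integral_def
  proof (intro Bochner_Integration.integral_cong refl)
    fix r :: "real^'m"
    show "indicator (ball 0 1) r *\<^sub>R (\<integral>\<theta>. indicator {0..1} \<theta> *\<^sub>R (G x r \<bullet> \<phi> (x + \<theta> *\<^sub>R F x r)) \<partial>lborel)
        = (\<integral>\<theta>. (case (x, r, \<theta>) of (x, r, \<theta>) \<Rightarrow> indicator E (x, r, \<theta>) * (G x r \<bullet> \<phi> (x + \<theta> *\<^sub>R F x r))) \<partial>lborel)"
      by (cases "r \<in> ball 0 1") (auto simp: E_def indicator_def)
  qed
  have [measurable]: "(\<lambda>z. F (fst z) (fst (snd z))) \<in> borel_measurable P"
    "(\<lambda>z. G (fst z) (fst (snd z))) \<in> borel_measurable P"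
    using measurable_compose[OF _ F_meas[folded borel_prod], of "\<lambda>z. (fst z, fst (snd z))" P]
      measurable_compose[OF _ G_meas[folded borel_prod], of "\<lambda>z. (fst z, fst (snd z))" P]
    by simp_all
  have [measurable]: "E \<in> sets P"
    using E_sets by (subst sets_P)
  have [measurable]: "\<Psi> \<in> borel_measurable P"
    unfolding \<Psi>_def case_prod_beta' by measurable
  have int_\<Phi>: "integrable P \<Phi>"
  proof (rule Bochner_Integration.integrable_bound)
    show "integrable P (\<lambda>z. C *\<^sub>R (indicator K (fst z) *\<^sub>R flux_density z))"
      using integrable_flux_density[OF K] by (rule integrable_scaleR_right)
    show "\<Phi> \<in> borel_measurable P"
      unfolding \<Phi>_def by measurable
    show "AE z in P. norm (\<Phi> z) \<le> norm (C *\<^sub>R (indicator K (fst z) *\<^sub>R flux_density z))"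
    proof (rule AE_I2)
      fix z
      show "norm (\<Phi> z) \<le> norm (C *\<^sub>R (indicator K (fst z) *\<^sub>R flux_density z))"
      proof (cases "fst z \<in> K")
        case True
        have "\<bar>\<Phi> z\<bar> \<le> norm (flux_density z) * norm (\<phi> (fst z))"
          unfolding \<Phi>_def by (rule Cauchy_Schwarz_ineq2)
        also have "\<dots> \<le> norm (flux_density z) * \<bar>C\<bar>"
          using bound[of "fst z"] by (intro mult_left_mono) auto
        finally show ?thesis
          using True by (simp add: mult.commute)
      qed (simp add: \<Phi>_def supp)
    qed
  qed
  then have [measurable]: "\<Phi> \<in> borel_measurable P"
    by auto
  \<comment> \<open>The substitution \<open>x = T\<^sup>-\<^sup>1 z\<close>, where \<open>T x = x + \<theta> F(x, r)\<close> for \<open>y = (r, \<theta>)\<close>.\<close>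
  have transfer:
      "(\<integral>x. \<Psi> (x, y) \<partial>lborel) = (\<integral>x. \<Phi> (x, y) \<partial>lborel)"
      "(\<integral>\<^sup>+x. norm (\<Psi> (x, y)) \<partial>lborel) = (\<integral>\<^sup>+x. norm (\<Phi> (x, y)) \<partial>lborel)" for y
  proof -
    obtain r \<theta> where y: "y = (r, \<theta>)"
      by fastforce
    have "(\<integral>x. \<Psi> (x, y) \<partial>lborel) = (\<integral>x. \<Phi> (x, y) \<partial>lborel) \<and>
      (\<integral>\<^sup>+x. norm (\<Psi> (x, y)) \<partial>lborel) = (\<integral>\<^sup>+x. norm (\<Phi> (x, y)) \<partial>lborel)"
    proof (cases "norm r < 1 \<and> 0 \<le> \<theta> \<and> \<theta> \<le> 1")
      case True
      define g where "g = jump_inv F \<theta> r"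
      define J where "J = jump_jacobian F \<theta> r"
      have bij: "bij g" and diff: "g differentiable (at x)" for x
        using True bij_jump_inv jump_inv_differentiable by (auto simp: g_def)
      then have [measurable]: "g \<in> borel_measurable borel"
        by (intro borel_measurable_continuous_onI)
           (auto intro!: continuous_at_imp_continuous_on differentiable_imp_continuous_within)
      have [measurable]: "J \<in> borel_measurable borel"
        unfolding J_def jump_jacobian_def g_def[symmetric]
        by (intro borel_measurable_abs borel_measurable_jacobian[where X = "\<lambda>x. x" and g = "\<lambda>_. g"]) (use diff in auto)
      have lborel_eq: "lborel = distr (density lborel (\<lambda>x. ennreal (J x))) borel g"
        using lborel_eq_distr_jacobian[OF bij diff] by (simp add: J_def jump_jacobian_def[abs_def] g_def)
      have [simp]: "0 \<le> J x" for x
        by (simp add: J_def jump_jacobian_def)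
      \<comment> \<open>By \<open>jump_inv_add\<close>, the argument of \<open>\<phi>\<close> in
        \<open>\<Psi> (g x, y)\<close> is \<open>x\<close> itself.\<close>
      have eq: "J x * \<Psi> (g x, y) = \<Phi> (x, y)" for x
        using True jump_inv_add[of r \<theta> x]
        by (simp add: \<Psi>_def \<Phi>_def flux_density_def y g_def J_def E_iff)
      have [measurable]: "(\<lambda>x. \<Psi> (x, y)) \<in> borel_measurable borel"
        by (rule measurable_compose[of "\<lambda>x. (x, y)" _ P]) (simp_all add: y space_pair_measure sets_eq_imp_space_eq[OF sets_\<nu>])
      have "(\<integral>x. \<Psi> (x, y) \<partial>lborel) = (\<integral>x. \<Psi> (x, y) \<partial>distr (density lborel (\<lambda>x. ennreal (J x))) borel g)"
        using lborel_eq by simp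
      also have "\<dots> = (\<integral>x. \<Phi> (x, y) \<partial>lborel)"
        by (subst integral_distr) (simp_all add: integral_density eq)
      finally have "(\<integral>x. \<Psi> (x, y) \<partial>lborel) = (\<integral>x. \<Phi> (x, y) \<partial>lborel)" .
      moreover have "(\<integral>\<^sup>+x. norm (\<Psi> (x, y)) \<partial>lborel) =
          (\<integral>\<^sup>+x. norm (\<Psi> (x, y)) \<partial>distr (density lborel (\<lambda>x. ennreal (J x))) borel g)"
        using lborel_eq by simp
      moreover have "\<dots> = (\<integral>\<^sup>+x. norm (\<Phi> (x, y)) \<partial>lborel)"
        by (subst nn_integral_distr) (simp_all add: nn_integral_density eq[symmetric] abs_mult ennreal_mult')
      ultimately show ?thesis
        by simp
    qed (auto simp: \<Psi>_def \<Phi>_def flux_density_def y E_iff)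
    then show "(\<integral>x. \<Psi> (x, y) \<partial>lborel) = (\<integral>x. \<Phi> (x, y) \<partial>lborel)"
      "(\<integral>\<^sup>+x. norm (\<Psi> (x, y)) \<partial>lborel) = (\<integral>\<^sup>+x. norm (\<Phi> (x, y)) \<partial>lborel)"
      by auto
  qed
  \<comment> \<open>With the order exchanged, \<open>x\<close> is integrated first for fixed
    \<open>(r, \<theta>)\<close>. There \<open>transfer\<close> equates the integrals of the norms,
    so the integrability of \<open>\<Phi>\<close> passes to \<open>\<Psi>\<close>.\<close>
  have int_\<Psi>: "integrable P \<Psi>"
  proof (rule integrableI_bounded)
    have "(\<integral>\<^sup>+z. norm (\<Psi> z) \<partial>P) = (\<integral>\<^sup>+z. norm (\<Phi> z) \<partial>P)"
      by (simp add: prod.nn_integral_snd[symmetric] transfer(2) del: real_norm_def)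
    also have "\<dots> < \<infinity>"
      using int_\<Phi> by (simp add: integrable_iff_bounded)
    finally show "(\<integral>\<^sup>+z. norm (\<Psi> z) \<partial>P) < \<infinity>" .
  qed measurable
  show "integrable lborel \<psi>"
    using integral_iterated_pair(1)[OF sf int_\<Psi>] by (simp add: \<psi>[abs_def])
  \<comment> \<open>\<open>\<phi> x\<close> leaves the inner integrals wherever the section of
    \<open>flux_density\<close> is integrable, which holds for almost every \<open>x\<close> in
    \<open>K\<close>; off \<open>K\<close> both sides are 0.\<close>
  have AE: "AE x in lborel. (\<integral>r. (\<integral>\<theta>. \<Phi> (x, r, \<theta>) \<partial>lborel) \<partial>\<nu>) = jump_flux F \<nu> G x \<bullet> \<phi> x"
    using prod.AE_integrable_fst'[OF integrable_flux_density[OF K]] prod.AE_integrable_fst'[OF int_\<Phi>]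
  proof eventually_elim
    case (elim x)
    show ?case
    proof (cases "x \<in> K")
      case True
      with elim have int: "integrable (\<nu> \<Otimes>\<^sub>M lborel) (\<lambda>y. flux_density (x, y))"
        by simp
      have "(\<integral>r. (\<integral>\<theta>. \<Phi> (x, r, \<theta>) \<partial>lborel) \<partial>\<nu>) = (\<integral>y. \<Phi> (x, y) \<partial>(\<nu> \<Otimes>\<^sub>M lborel))"
        using marks.integral_fst'[OF elim(2)] by simp
      also have "\<dots> = (\<integral>y. flux_density (x, y) \<partial>(\<nu> \<Otimes>\<^sub>M lborel)) \<bullet> \<phi> x"
        using int by (simp add: \<Phi>_def)
      also have "\<dots> = jump_flux F \<nu> G x \<bullet> \<phi> x"
        using marks.integral_fst'[OF int] by (simp add: jump_flux_eq)
      finally show ?thesis .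
    qed (simp add: \<Phi>_def supp)
  qed
  note \<Phi>_iter = integral_iterated_pair[OF sf int_\<Phi>]
  have meas_flux: "(\<lambda>x. jump_flux F \<nu> G x \<bullet> \<phi> x) \<in> borel_measurable lborel"
    unfolding jump_flux_eq by measurable
  have meas_\<Phi>: "(\<lambda>x. (\<integral>r. (\<integral>\<theta>. \<Phi> (x, r, \<theta>) \<partial>lborel) \<partial>\<nu>)) \<in> borel_measurable lborel"
    using \<Phi>_iter(1) by (rule borel_measurable_integrable)
  show "integrable lborel (\<lambda>x. jump_flux F \<nu> G x \<bullet> \<phi> x)"
    using \<Phi>_iter(1) integrable_cong_AE[OF meas_\<Phi> meas_flux AE] by simp
  have "(\<integral>x. jump_flux F \<nu> G x \<bullet> \<phi> x \<partial>lborel) = integral\<^sup>L P \<Phi>"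
    using \<Phi>_iter(2) integral_cong_AE[OF meas_\<Phi> meas_flux AE] by simp
  also have "\<dots> = integral\<^sup>L P \<Psi>"
    using prod.integral_snd[of "\<lambda>x y. \<Phi> (x, y)"] prod.integral_snd[of "\<lambda>x y. \<Psi> (x, y)"] int_\<Phi> int_\<Psi>
    by (simp add: transfer(1))
  also have "\<dots> = (\<integral>x. \<psi> x \<partial>lborel)"
    using integral_iterated_pair(2)[OF sf int_\<Psi>] by (simp add: \<psi>)
  finally show "(\<integral>x. \<psi> x \<partial>lborel) = (\<integral>x. jump_flux F \<nu> G x \<bullet> \<phi> x \<partial>lborel)"
    by simp
qed

end

section \<open>The generator applied to a product\<close>

lemma bounded_if_continuous_support:
  assumes "continuous_on UNIV (h :: 'a::topological_space \<Rightarrow> 'b::real_normed_vector)" "compact K" "\<And>x. x \<notin> K \<Longrightarrow> h x = 0"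
  obtains C where "0 \<le> C" "\<And>x. norm (h x) \<le> C"
proof -
  have "bounded (h ` K)"
    using assms by (intro compact_imp_bounded compact_continuous_image) (auto intro: continuous_on_subset)
  then obtain C where C: "\<And>x. x \<in> K \<Longrightarrow> norm (h x) \<le> C"
    by (auto simp: bounded_iff)
  have "norm (h x) \<le> max 0 C" for x
    using C[of x] assms(3)[of x] by (cases "x \<in> K") auto
  then show ?thesis
    using that[of "max 0 C"] by simp
qed

lemma C2cD:
  assumes "f \<in> C2c S"
  shows "Ck_on 2 UNIV f" "compact (closure {x. f x \<noteq> 0})" "closure {x. f x \<noteq> 0} \<subseteq> S"
    "Ck_on (Suc (Suc 0)) UNIV f" "f differentiable (at x)" "partial i f differentiable (at x)"
    "continuous_on UNIV f" "continuous_on UNIV (grad f)" "continuous_on UNIV (partial i (partial j f))"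
  using assms Ck_on_Suc_continuous_on_grad[of "Suc 0" UNIV f] Ck_on_Suc_continuous_on[of "Suc 0" UNIV f]
  by (auto simp: C2c_def numeral_2_eq_2)

text \<open>The gradient is bounded, being continuous with compact support. The estimate bounds the
  increment of \<open>f\<close> over a jump by a multiple of the jump size.\<close>

lemma C2c_lipschitz:
  assumes "f \<in> C2c S"
  obtains C where "0 \<le> C" "\<And>x v. \<bar>f (x + v) - f x\<bar> \<le> C * norm v"
proof -
  obtain C where C: "0 \<le> C" "\<And>x. norm (grad f x) \<le> C"
    using bounded_if_continuous_support[OF C2cD(8)[OF assms] C2cD(2)[OF assms], OF grad_support] by blast
  have "norm (f (x + v) - f x) \<le> C * norm (x + v - x)" for x v
  proof (rule differentiable_bound[of UNIV f "\<lambda>x h. h \<bullet> grad f x"])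
    show "(f has_derivative (\<lambda>h. h \<bullet> grad f x)) (at x within UNIV)" for x
      using has_derivative_grad[OF C2cD(5)[OF assms]] .
    show "onorm (\<lambda>h. h \<bullet> grad f x) \<le> C" for x
    proof (rule onorm_le)
      fix h
      have "norm (h \<bullet> grad f x) \<le> norm h * norm (grad f x)"
        using Cauchy_Schwarz_ineq2 by simp
      also have "\<dots> \<le> norm h * C"
        using C(2) by (intro mult_left_mono) auto
      finally show "norm (h \<bullet> grad f x) \<le> C * norm h"
        by (simp add: mult.commute)
    qed
  qed auto
  with C(1) show ?thesis
    using that by simp
qed

text \<open>A jump may carry \<open>x\<close> far from where \<open>q\<close> is known to be smooth,
  so no Lipschitz bound is at hand. Within the radius \<open>d\<close> belonging to error constant 1
  the derivative controls the increment; beyond it the increment is at most \<open>2 * B\<close>,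
  and \<open>norm v / d\<close> is at least 1.\<close>

lemma differentiable_bounded_increment:
  fixes q :: "'a::real_normed_vector \<Rightarrow> real"
  assumes "q differentiable (at x)" and B: "\<And>y. \<bar>q y\<bar> \<le> B"
  obtains C where "\<And>v. \<bar>q (x + v) - q x\<bar> \<le> C * norm v"
proof -
  obtain D where D: "(q has_derivative D) (at x)"
    using assms(1) by (auto simp: differentiable_def)
  then obtain d where d: "0 < d"
    "\<And>y. norm (y - x) < d \<Longrightarrow> norm (q y - q x - D (y - x)) \<le> 1 * norm (y - x)"
    unfolding has_derivative_at_alt by (meson zero_less_one)
  have lin: "bounded_linear D"
    using D by (rule has_derivative_bounded_linear)
  have "\<bar>q (x + v) - q x\<bar> \<le> max (1 + onorm D) (2 * B / d) * norm v" for v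
  proof (cases "norm v < d")
    case True
    then have "\<bar>q (x + v) - q x\<bar> \<le> norm v + \<bar>D v\<bar>"
      using d(2)[of "x + v"] by simp
    also have "\<dots> \<le> norm v + onorm D * norm v"
      using onorm[OF lin, of v] by simp
    also have "\<dots> = (1 + onorm D) * norm v"
      by (simp add: algebra_simps)
    also have "\<dots> \<le> max (1 + onorm D) (2 * B / d) * norm v"
      by (intro mult_right_mono) auto
    finally show ?thesis .
  next
    case False
    have "0 \<le> B"
      using B[of x] by linarith
    have "\<bar>q (x + v) - q x\<bar> \<le> 2 * B"
      using B[of "x + v"] B[of x] by linarith
    also have "\<dots> = (2 * B / d) * d"
      using d by simp
    also have "\<dots> \<le> (2 * B / d) * norm v"
      using False \<open>0 \<le> B\<close> d(1) by (intro mult_left_mono) auto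
    also have "\<dots> \<le> max (1 + onorm D) (2 * B / d) * norm v"
      by (intro mult_right_mono) auto
    finally show ?thesis .
  qed
  then show ?thesis
    using that by blast
qed

lemma diffusion_matrix_symmetric: "diffusion_matrix \<sigma> x $ i $ j = diffusion_matrix \<sigma> x $ j $ i"
  by (simp add: diffusion_matrix_def matrix_matrix_mult_def transpose_def mult.commute)

text \<open>The left side collects the cross terms of the second-order product rule. Symmetry makes
  the two halves equal, and the resulting 2 cancels the 1/2 of the generator.\<close>

lemma symmetric_inner_halves:
  fixes A :: "real^'n^'n"
  assumes "\<And>i j. A $ i $ j = A $ j $ i"
  shows "(\<Sum>i\<in>UNIV. \<Sum>j\<in>UNIV. A $ i $ j * (u $ j * w $ i + u $ i * w $ j)) = 2 * ((A *v u) \<bullet> w)"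
proof -
  have "(\<Sum>i\<in>UNIV. \<Sum>j\<in>UNIV. A $ i $ j * (u $ i * w $ j)) = (\<Sum>i\<in>UNIV. \<Sum>j\<in>UNIV. A $ i $ j * (u $ j * w $ i))"
    by (subst sum.swap) (simp add: assms[of _ _])
  moreover have "(A *v u) \<bullet> w = (\<Sum>i\<in>UNIV. \<Sum>j\<in>UNIV. A $ i $ j * (u $ j * w $ i))"
    by (simp add: inner_vec_def matrix_vector_mult_def sum_distrib_right mult.assoc)
  ultimately show ?thesis
    by (simp add: distrib_left sum.distrib)
qed

text \<open>The local terms are the product rule. In the jump term the increment of
  \<open>q f\<close> is \<open>f x\<close> times the increment of \<open>q\<close> plus
  \<open>q (x + F x r)\<close> times the increment of \<open>f\<close>; integrability of
  \<open>F x\<close> over the unit ball allows \<open>q x * (F x r \<bullet> grad f x)\<close> to be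
  split off as the compensator drift.\<close>

lemma generator_mult:
  fixes F :: "real^'n \<Rightarrow> real^'m \<Rightarrow> real^'n"
  assumes sets_\<nu> [measurable_cong]: "sets \<nu> = sets borel"
    and S: "open S" and q: "Ck_on 2 S q" and q_bound: "\<And>y. \<bar>q y\<bar> \<le> B" and q_meas [measurable]: "q \<in> borel_measurable borel"
    and f: "f \<in> C2c S"
    and F_meas [measurable]: "F x \<in> borel_measurable borel"
    and F_int: "set_integrable \<nu> (ball 0 1) (F x)"
  shows "generator b \<sigma> F \<nu> (\<lambda>y. q y * f y) x =
      f x * generator b \<sigma> F \<nu> q x
      + q x * ((b x - compensator_drift F \<nu> x) \<bullet> grad f x)
      + (diffusion_matrix \<sigma> x *v grad q x) \<bullet> grad f x
      + 1/2 * (\<Sum>i\<in>UNIV. \<Sum>j\<in>UNIV. diffusion_matrix \<sigma> x $ i $ j * (q x * partial i (partial j f) x))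
      + (LINT r:ball 0 1|\<nu>. q (x + F x r) * (f (x + F x r) - f x))"
proof (cases "x \<in> S")
  \<comment> \<open>Here \<open>f\<close> vanishes near \<open>x\<close>, so all local terms are 0,
    but jumps may still reach the support of \<open>f\<close>. Both jump integrands reduce to
    \<open>q (x + F x r) * f (x + F x r)\<close>.\<close>
  case False
  then have notin: "x \<notin> closure {x. f x \<noteq> 0}"
    using C2cD(3)[OF f] by auto
  have sub: "closure {x. q x * f x \<noteq> 0} \<subseteq> closure {x. f x \<noteq> 0}"
    by (intro closure_mono) auto
  have "f x = 0"
    using notin closure_subset[of "{x. f x \<noteq> 0}"] by auto
  moreover have "grad f x = 0" "grad (\<lambda>y. q y * f y) x = 0"
    using notin sub by (auto intro!: grad_support)
  moreover have "partial i (partial j f) x = 0" "partial i (partial j (\<lambda>y. q y * f y)) x = 0" for i j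
    using notin sub closure_support_partial[of j f] closure_support_partial[of j "\<lambda>y. q y * f y"]
    by (auto intro!: partial_support)
  ultimately show ?thesis
    by (simp add: generator_def)
next
  case True
  have dq: "q differentiable (at y)" "partial i q differentiable (at y)" if "y \<in> S" for i y
    using q that by (auto simp: numeral_2_eq_2)
  note df = C2cD(5,6)[OF f]
  have grad: "grad (\<lambda>y. q y * f y) x = f x *\<^sub>R grad q x + q x *\<^sub>R grad f x"
    using dq(1)[OF True] df(1) by (rule grad_mult)
  have snd: "partial i (partial j (\<lambda>y. q y * f y)) x = f x * partial i (partial j q) x + q x * partial i (partial j f) x
      + (grad q x $ j * grad f x $ i + grad q x $ i * grad f x $ j)" for i j
  proof -
    have "partial i (partial j (\<lambda>y. q y * f y)) x = partial i (\<lambda>y. partial j q y * f y + q y * partial j f y) x"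
      using S True partial_mult[OF dq(1) df(1)] by (intro partial_cong_open[of S]) auto
    also have "\<dots> = partial i (\<lambda>y. partial j q y * f y) x + partial i (\<lambda>y. q y * partial j f y) x"
      using dq[OF True] df by (intro partial_add differentiable_mult) auto
    also have "\<dots> = f x * partial i (partial j q) x + q x * partial i (partial j f) x
      + (grad q x $ j * grad f x $ i + grad q x $ i * grad f x $ j)"
      using dq[OF True] df by (simp add: partial_mult grad_def algebra_simps)
    finally show ?thesis .
  qed
  let ?A = "diffusion_matrix \<sigma> x"
  have sums: "(\<Sum>i\<in>UNIV. \<Sum>j\<in>UNIV. ?A $ i $ j * partial i (partial j (\<lambda>y. q y * f y)) x)
    = f x * (\<Sum>i\<in>UNIV. \<Sum>j\<in>UNIV. ?A $ i $ j * partial i (partial j q) x)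
      + (\<Sum>i\<in>UNIV. \<Sum>j\<in>UNIV. ?A $ i $ j * (q x * partial i (partial j f) x))
      + 2 * ((?A *v grad q x) \<bullet> grad f x)"
    unfolding snd symmetric_inner_halves[OF diffusion_matrix_symmetric, symmetric]
    by (simp add: sum.distrib sum_distrib_left distrib_left mult_ac)
  define I1 where "I1 = (\<lambda>r. q (x + F x r) - q x - F x r \<bullet> grad q x)"
  define I2 where "I2 = (\<lambda>r. q (x + F x r) * (f (x + F x r) - f x))"
  have [measurable]: "f \<in> borel_measurable borel"
    using C2cD(7)[OF f] by (rule borel_measurable_continuous_onI)
  have F_ball: "integrable \<nu> (\<lambda>r. indicator (ball 0 1) r *\<^sub>R F x r)"
    using F_int by (simp add: set_integrable_def)
  \<comment> \<open>All three pieces of the jump integrand are dominated by multiples of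
    \<open>norm (F x r)\<close>; their separate integrability justifies splitting the
    integral.\<close>
  have int_if: "set_integrable \<nu> (ball 0 1) h"
    if "h \<in> borel_measurable borel" and "\<And>r. \<bar>h r\<bar> \<le> C * norm (F x r)" for h :: "real^'m \<Rightarrow> real" and C
    unfolding set_integrable_def
  proof (rule Bochner_Integration.integrable_bound)
    show "integrable \<nu> (\<lambda>r. C *\<^sub>R (indicator (ball 0 1) r *\<^sub>R F x r))"
      using F_ball by (rule integrable_scaleR_right)
    show "AE r in \<nu>. norm (indicator (ball 0 1) r *\<^sub>R h r) \<le> norm (C *\<^sub>R (indicator (ball 0 1) r *\<^sub>R F x r))"
    proof (rule AE_I2)
      fix r
      have "\<bar>h r\<bar> \<le> \<bar>C\<bar> * norm (F x r)"
        using that(2)[of r] mult_right_mono[OF abs_ge_self norm_ge_zero, of C "F x r"] by linarith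
      then show "norm (indicator (ball 0 1) r *\<^sub>R h r) \<le> norm (C *\<^sub>R (indicator (ball 0 1) r *\<^sub>R F x r))"
        by (simp add: indicator_def)
    qed
    have "(\<lambda>r. indicator (ball 0 1) r *\<^sub>R h r) \<in> borel_measurable borel"
      by (intro borel_measurable_scaleR borel_measurable_indicator that) simp
    then show "(\<lambda>r. indicator (ball 0 1) r *\<^sub>R h r) \<in> borel_measurable \<nu>"
      by (simp cong: measurable_cong_sets add: sets_\<nu>)
  qed
  have int_grad: "set_integrable \<nu> (ball 0 1) (\<lambda>r. F x r \<bullet> u)" for u
  proof (rule int_if[of _ "norm u"])
    show "\<bar>F x r \<bullet> u\<bar> \<le> norm u * norm (F x r)" for r
      using Cauchy_Schwarz_ineq2[of "F x r" u] by (simp add: mult.commute)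
  qed measurable
  have int_I1: "set_integrable \<nu> (ball 0 1) I1"
  proof -
    obtain C where "\<And>v. \<bar>q (x + v) - q x\<bar> \<le> C * norm v"
      using differentiable_bounded_increment[OF dq(1)[OF True] q_bound] by blast
    then have "set_integrable \<nu> (ball 0 1) (\<lambda>r. q (x + F x r) - q x)"
      by (intro int_if) measurable
    then show ?thesis
      unfolding I1_def by (rule set_integral_diff(1)[OF _ int_grad])
  qed
  have int_I2: "set_integrable \<nu> (ball 0 1) I2"
  proof -
    obtain C where C: "0 \<le> C" "\<And>x v. \<bar>f (x + v) - f x\<bar> \<le> C * norm v"
      using C2c_lipschitz[OF f] by blast
    have "\<bar>q (x + F x r) * (f (x + F x r) - f x)\<bar> \<le> B * C * norm (F x r)" for r
      unfolding abs_mult mult.assoc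
      using C(2) q_bound by (intro mult_mono) (auto intro: order_trans[OF abs_ge_zero q_bound])
    then show ?thesis
      unfolding I2_def by (intro int_if[of _ "B * C"]) measurable
  qed
  have "(LINT r:ball 0 1|\<nu>. q (x + F x r) * f (x + F x r) - q x * f x - F x r \<bullet> grad (\<lambda>y. q y * f y) x)
      = (LINT r:ball 0 1|\<nu>. (f x * I1 r + I2 r) - q x * (F x r \<bullet> grad f x))"
    unfolding grad I1_def I2_def by (simp add: inner_add_right algebra_simps)
  also have "\<dots> = f x * (LINT r:ball 0 1|\<nu>. I1 r) + (LINT r:ball 0 1|\<nu>. I2 r) - q x * (LINT r:ball 0 1|\<nu>. F x r \<bullet> grad f x)"
    using int_I1 int_I2 int_grad by (simp add: set_integral_add set_integral_diff)
  also have "(LINT r:ball 0 1|\<nu>. F x r \<bullet> grad f x) = compensator_drift F \<nu> x \<bullet> grad f x"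
    unfolding compensator_drift_def set_lebesgue_integral_def
    using F_ball by (simp flip: integral_inner_left)
  finally have jump: "(LINT r:ball 0 1|\<nu>. q (x + F x r) * f (x + F x r) - q x * f x - F x r \<bullet> grad (\<lambda>y. q y * f y) x)
    = f x * (LINT r:ball 0 1|\<nu>. I1 r) + (LINT r:ball 0 1|\<nu>. I2 r) - q x * (compensator_drift F \<nu> x \<bullet> grad f x)" .
  show ?thesis
    unfolding generator_def jump sums
    unfolding grad I1_def[symmetric] I2_def[symmetric]
    by (simp add: inner_add_right inner_diff_left algebra_simps)
qed

section \<open>The forward equation of the Doob transform in divergence form\<close>

lemma integrable_inner_bounded:
  fixes u \<phi> :: "'a::euclidean_space \<Rightarrow> 'b::euclidean_space"
  assumes u: "set_integrable lborel K u" and \<phi>: "\<phi> \<in> borel_measurable borel"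
    and bound: "\<And>x. norm (\<phi> x) \<le> C" and supp: "\<And>x. x \<notin> K \<Longrightarrow> \<phi> x = 0"
  shows "integrable lborel (\<lambda>x. u x \<bullet> \<phi> x)"
proof -
  \<comment> \<open>Measurability is available for the cutoff of \<open>u\<close> to
    \<open>K\<close>, not for \<open>u\<close> itself, so the product is rewritten with the
    cutoff.\<close>
  have eq: "u x \<bullet> \<phi> x = (indicator K x *\<^sub>R u x) \<bullet> \<phi> x" for x
    using supp[of x] by (cases "x \<in> K") simp_all
  have uK: "integrable lborel (\<lambda>x. indicator K x *\<^sub>R u x)"
    using u by (simp add: set_integrable_def)
  show ?thesis
  proof (rule Bochner_Integration.integrable_bound)
    show "integrable lborel (\<lambda>x. C *\<^sub>R (indicator K x *\<^sub>R u x))"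
      using uK by (rule integrable_scaleR_right)
    show "(\<lambda>x. u x \<bullet> \<phi> x) \<in> borel_measurable lborel"
      unfolding eq using borel_measurable_integrable[OF uK] \<phi> by (intro borel_measurable_inner) auto
    show "AE x in lborel. norm (u x \<bullet> \<phi> x) \<le> norm (C *\<^sub>R (indicator K x *\<^sub>R u x))"
    proof (rule AE_I2)
      fix x
      have "\<bar>u x \<bullet> \<phi> x\<bar> \<le> norm (indicator K x *\<^sub>R u x) * norm (\<phi> x)"
        unfolding eq by (rule Cauchy_Schwarz_ineq2)
      also have "\<dots> \<le> norm (indicator K x *\<^sub>R u x) * \<bar>C\<bar>"
        using bound[of x] by (intro mult_left_mono) auto
      finally show "norm (u x \<bullet> \<phi> x) \<le> norm (C *\<^sub>R (indicator K x *\<^sub>R u x))"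
        by (simp add: abs_mult mult_ac)
    qed
  qed
qed

lemma integrable_vec:
  fixes f :: "'a \<Rightarrow> real^'n"
  assumes "\<And>i. integrable M (\<lambda>x. f x $ i)"
  shows "integrable M f"
proof -
  have "f = (\<lambda>x. \<Sum>i\<in>UNIV. f x $ i *\<^sub>R axis i 1)"
    using basis_expansion[of "f _"] by (simp add: fun_eq_iff scalar_mult_eq_scaleR)
  moreover have "integrable M (\<lambda>x. \<Sum>i\<in>UNIV. f x $ i *\<^sub>R (axis i 1 :: real^'n))"
    using assms by (intro Bochner_Integration.integrable_sum integrable_scaleR_left)
  ultimately show ?thesis
    by simp
qed

lemma norm_vec_le_sum: "norm x \<le> (\<Sum>i\<in>UNIV. norm (x $ i))"
  unfolding norm_vec_def[of x] by (rule L2_set_le_sum) simp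

text \<open>Writing the quadratic expression as an inner product of matrices isolates
  \<open>A\<close>, so that local integrability of the matrix field \<open>\<rho> \<Sigma>\<close>
  can be used as it is assumed.\<close>

lemma matrix_vector_inner_eq:
  fixes A :: "real^'n^'n"
  shows "(A *v u) \<bullet> w = A \<bullet> (\<chi> i. w $ i *\<^sub>R u)"
  by (simp add: inner_vec_def matrix_vector_mult_def sum_distrib_left sum_distrib_right mult_ac)

lemma borel_measurable_vec_lambda:
  fixes f :: "'i::finite \<Rightarrow> 'a \<Rightarrow> 'b::euclidean_space"
  assumes "\<And>i. f i \<in> borel_measurable M"
  shows "(\<lambda>x. \<chi> i. f i x) \<in> borel_measurable M"
  unfolding borel_measurable_euclidean_space[where 'c = "'b^'i"]
  using assms by (auto simp: Basis_vec_def inner_axis)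

text \<open>Continuity is available only off the two closed sets, and there the values are
  prescribed; \<open>q\<close> is a sum of two Borel pieces.\<close>

lemma borel_measurable_committor:
  fixes q :: "real^'n \<Rightarrow> real"
  assumes q: "continuous_on (- (closure A \<union> closure B)) q"
    and A: "\<And>x. x \<in> closure A \<Longrightarrow> q x = 0" and B: "\<And>x. x \<in> closure B \<Longrightarrow> q x = 1"
  shows "q \<in> borel_measurable borel"
proof -
  let ?S = "- (closure A \<union> closure B)"
  have "q = (\<lambda>x. indicator ?S x *\<^sub>R q x + indicator (closure B) x)"
    using A B by (auto simp: fun_eq_iff indicator_def)
  moreover have "(\<lambda>x. indicator ?S x *\<^sub>R q x + indicator (closure B) x) \<in> borel_measurable borel"
    using q by (intro borel_measurable_add borel_measurable_continuous_on_indicator borel_measurable_indicator) auto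
  ultimately show ?thesis
    by simp
qed

text \<open>Only analytic consequences of the probabilistic setting remain: \<open>q\<close> enters
  through its bounds, its regularity and its equation on \<open>S\<close>. The factor
  \<open>g\<close> stands in for the backward committor, since the divergence form is demanded for a
  whole class of densities.\<close>

locale transition_setting =
  fixes \<nu> :: "(real^'m) measure" and b :: "real^'n::{finite,wellorder} \<Rightarrow> real^'n::_"
    and \<sigma> :: "real^'n::_ \<Rightarrow> real^'n::_^'n::_" and F :: "real^'n::_ \<Rightarrow> real^'m \<Rightarrow> real^'n::_"
    and \<rho> q g :: "real^'n::_ \<Rightarrow> real" and S :: "(real^'n::_) set"
  assumes levy: "levy_measure \<nu>"
    and F_meas: "case_prod F \<in> borel_measurable borel"
    and jump_maps: "regular_jump_maps F"
    and forward_eq: "stationary_forward_equation b \<sigma> F \<nu> \<rho>"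
    and \<rho>_meas [measurable]: "\<rho> \<in> borel_measurable borel" and \<rho>_nonneg: "0 \<le> \<rho> x"
    and S_open: "open S"
    and q_meas [measurable]: "q \<in> borel_measurable borel" and q_C2: "Ck_on 2 S q"
    and q_bound: "0 \<le> q x" "q x \<le> 1" and q_pos: "x \<in> S \<Longrightarrow> 0 < q x"
    and q_eq: "x \<in> S \<Longrightarrow> generator b \<sigma> F \<nu> q x = 0"
    and g_adm: "g \<in> admissible_factors \<sigma> \<rho> q S"
begin

abbreviation "c \<equiv> compensator_drift F \<nu>"
abbreviation "\<Sigma> \<equiv> diffusion_matrix \<sigma>"
abbreviation "G \<equiv> \<lambda>y r. (q (y + F y r) * \<rho> y * g y) *\<^sub>R F y r"
abbreviation "m \<equiv> \<lambda>i j x. \<Sigma> x $ i $ j * (\<rho> x * q x * g x)"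

lemma sets_\<nu>: "sets \<nu> = sets borel"
  using levy by (simp add: levy_measure_def)

lemma g_meas [measurable]: "g \<in> borel_measurable borel"
  using g_adm by (simp add: admissible_factors_def)

lemma g_bounded: obtains C where "0 < C" "\<And>x. \<bar>g x\<bar> \<le> C"
  using g_adm by (auto simp: admissible_factors_def bounded_pos)

lemma m_C1: "Ck_on 1 S (m i j)"
  using g_adm by (simp add: admissible_factors_def)

lemma F_section_meas: "F x \<in> borel_measurable borel"
  using measurable_compose[OF _ F_meas[folded borel_prod], of "\<lambda>r. (x, r)" borel] by simp

lemma jump_kernel_scaled:
  assumes [measurable]: "(\<lambda>(y, r). h y r) \<in> borel_measurable borel"
  shows "jump_kernel \<nu> F (\<lambda>y r. h y r *\<^sub>R F y r)"
proof
  show "(\<lambda>(y, r). h y r *\<^sub>R F y r) \<in> borel_measurable borel"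
    using borel_measurable_scaleR[OF assms F_meas] by (simp add: case_prod_beta')
qed (use sets_\<nu> F_meas jump_maps sigma_finite_measure.sigma_finite_countable[OF sigma_finite_levy_measure[OF levy]] in auto)

text \<open>Since \<open>q\<close> lies between 0 and 1 and \<open>g\<close> is bounded by some
  \<open>C\<close>, the flux density is at most \<open>C\<close> times the one of
  \<open>\<rho> F\<close>, whose integrability over compact sets is part of the stationary
  equation.\<close>

lemma finite_jump_kernel: "finite_jump_kernel \<nu> F G"
proof -
  have "(\<lambda>(y, r). \<rho> y) \<in> borel_measurable (borel :: ((real^'n::_) \<times> (real^'m)) measure)"
    unfolding borel_prod[symmetric] by measurable
  then interpret F0: jump_kernel \<nu> F "\<lambda>y r. \<rho> y *\<^sub>R F y r"
    by (rule jump_kernel_scaled)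
  have "(\<lambda>(y, r). q (y + F y r) * \<rho> y * g y) \<in> borel_measurable borel"
    using F_meas unfolding borel_prod[symmetric] by measurable
  then interpret F1: jump_kernel \<nu> F G
    by (rule jump_kernel_scaled)
  obtain C where C: "0 < C" "\<And>x. \<bar>g x\<bar> \<le> C"
    using g_bounded by blast
  show ?thesis
  proof
    fix K :: "(real^'n::_) set" assume K: "compact K"
    have "(\<integral>\<^sup>+ x\<in>K. (\<integral>\<^sup>+ r\<in>ball 0 1. (\<integral>\<^sup>+ \<theta>\<in>{0..1}.
           ennreal (norm (\<rho> (jump_inv F \<theta> r x) *\<^sub>R F (jump_inv F \<theta> r x) r) * jump_jacobian F \<theta> r x)
           \<partial>lborel) \<partial>\<nu>) \<partial>lborel) < \<infinity>"
      using forward_eq K \<rho>_nonneg by (simp add: stationary_forward_equation_def)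
    then have "integrable F0.P (\<lambda>z. indicator K (fst z) *\<^sub>R F0.flux_density z)"
      by (rule F0.integrable_flux_densityI[OF K])
    then have int: "integrable F0.P (\<lambda>z. C *\<^sub>R (indicator K (fst z) *\<^sub>R F0.flux_density z))"
      by (rule integrable_scaleR_right)
    have [measurable]: "K \<in> sets borel"
      using K by (simp add: borel_compact)
    show "integrable F0.P (\<lambda>z. indicator K (fst z) *\<^sub>R F1.flux_density z)"
    proof (rule Bochner_Integration.integrable_bound[OF int])
      show "(\<lambda>z. indicator K (fst z) *\<^sub>R F1.flux_density z) \<in> borel_measurable F0.P"
        by measurable
      show "AE z in F0.P. norm (indicator K (fst z) *\<^sub>R F1.flux_density z) \<le> norm (C *\<^sub>R (indicator K (fst z) *\<^sub>R F0.flux_density z))"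
      proof (rule AE_I2)
        fix z :: "(real^'n::_) \<times> (real^'m) \<times> real"
        obtain x r \<theta> where z: "z = (x, r, \<theta>)"
          by (cases z)
        define y where "y = jump_inv F \<theta> r x"
        have "\<bar>q (y + F y r) * \<rho> y * g y\<bar> \<le> C * \<rho> y"
        proof -
          have "\<bar>q (y + F y r) * \<rho> y * g y\<bar> = (q (y + F y r) * \<bar>g y\<bar>) * \<rho> y"
            using \<rho>_nonneg q_bound by (simp add: abs_mult)
          also have "\<dots> \<le> (1 * C) * \<rho> y"
            using \<rho>_nonneg q_bound C by (intro mult_right_mono mult_mono) auto
          finally show ?thesis
            by simp
        qed
        then have "\<bar>q (y + F y r) * \<rho> y * g y\<bar> * (jump_jacobian F \<theta> r x * norm (F y r))
            \<le> C * \<rho> y * (jump_jacobian F \<theta> r x * norm (F y r))"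
          by (intro mult_right_mono) (auto simp: jump_jacobian_def)
        then show "norm (indicator K (fst z) *\<^sub>R F1.flux_density z) \<le> norm (C *\<^sub>R (indicator K (fst z) *\<^sub>R F0.flux_density z))"
          using C(1) \<rho>_nonneg[of y]
          unfolding F1.flux_density_def F0.flux_density_def z prod.case y_def[symmetric]
          by (simp add: jump_jacobian_def indicator_def abs_mult mult_ac)
      qed
    qed
  qed
qed

sublocale flux: finite_jump_kernel \<nu> F G
  by (rule finite_jump_kernel)

section \<open>The drift part of the current\<close>

definition drift :: "real^'n::_ \<Rightarrow> real^'n::_" where
  "drift x = (\<rho> x * q x * g x) *\<^sub>R (b x + \<Sigma> x *v (grad q x /\<^sub>R q x) - c x)"

lemma diffusion_inner:
  "(\<rho> x *\<^sub>R \<Sigma> x) \<bullet> (\<chi> i. w $ i *\<^sub>R (g x *\<^sub>R u)) = \<rho> x * g x * ((\<Sigma> x *v u) \<bullet> w)"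
  using matrix_vector_inner_eq[of "\<Sigma> x" "g x *\<^sub>R u" w]
  unfolding inner_scaleR_left by (simp add: matrix_vector_mult_scaleR)

text \<open>On \<open>S\<close> the factor \<open>q\<close> cancels \<open>1/q\<close>. What remains
  pairs the locally integrable fields \<open>\<rho> (b - c)\<close> and
  \<open>\<rho> \<Sigma>\<close> with fields that are bounded on compact subsets of \<open>S\<close>
  when \<open>w\<close> is.\<close>

lemma drift_inner:
  assumes "x \<in> S"
  shows "drift x \<bullet> w = (\<rho> x *\<^sub>R (b x - c x)) \<bullet> ((q x * g x) *\<^sub>R w)
      + (\<rho> x *\<^sub>R \<Sigma> x) \<bullet> (\<chi> i. w $ i *\<^sub>R (g x *\<^sub>R grad q x))"
proof -
  have drift_term: "\<Sigma> x *v (grad q x /\<^sub>R q x) = (\<Sigma> x *v grad q x) /\<^sub>R q x"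
    by (simp add: matrix_vector_mult_scaleR)
  show ?thesis
    unfolding diffusion_inner drift_def drift_term
    using q_pos[OF assms] by (simp add: inner_add_left inner_diff_left algebra_simps)
qed

lemma integrable_drift_inner:
  assumes K: "compact K" "K \<subseteq> S" and [measurable]: "\<phi> \<in> borel_measurable borel"
    and bound: "\<And>x. norm (\<phi> x) \<le> C" and supp: "\<And>x. x \<notin> K \<Longrightarrow> \<phi> x = 0"
  shows "integrable lborel (\<lambda>x. drift x \<bullet> \<phi> x)"
proof -
  obtain Cg where Cg: "0 < Cg" "\<And>x. \<bar>g x\<bar> \<le> Cg"
    using g_bounded by blast
  have C_nonneg: "0 \<le> C"
    using bound[of 0] norm_ge_zero order_trans by blast
  have cont: "continuous_on K (grad q)"
    using Ck_on_Suc_continuous_on_grad[of 1 S q] q_C2 K by (auto simp: numeral_2_eq_2 intro: continuous_on_subset)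
  have K_sets [measurable]: "K \<in> sets borel"
    using K by (simp add: borel_compact)
  \<comment> \<open>\<open>grad q\<close> is controlled only on compact subsets of \<open>S\<close>;
    its cutoff to \<open>K\<close> is bounded and Borel on the whole space, and
    \<open>\<phi>\<close> vanishes off \<open>K\<close> anyway.\<close>
  define gq where "gq = (\<lambda>x. indicator K x *\<^sub>R grad q x)"
  have gq_meas: "gq \<in> borel_measurable borel"
    unfolding gq_def by (rule borel_measurable_continuous_on_indicator[OF K_sets cont])
  obtain Cq where Cq: "0 < Cq" "\<And>x. norm (gq x) \<le> Cq"
  proof -
    have "bounded (grad q ` K)"
      using cont K by (intro compact_imp_bounded compact_continuous_image)
    then obtain B where "0 < B" "\<And>x. x \<in> K \<Longrightarrow> norm (grad q x) \<le> B"
      by (auto simp: bounded_pos)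
    then show ?thesis
      using that[of B] by (auto simp: gq_def indicator_def)
  qed
  have "integrable lborel (\<lambda>x. (\<rho> x *\<^sub>R (b x - c x)) \<bullet> ((q x * g x) *\<^sub>R \<phi> x))"
  proof (rule integrable_inner_bounded)
    show "set_integrable lborel K (\<lambda>x. \<rho> x *\<^sub>R (b x - c x))"
      using forward_eq K(1) by (auto simp: stationary_forward_equation_def locally_integrable_on_def)
    show "norm ((q x * g x) *\<^sub>R \<phi> x) \<le> (1 * Cg) * C" for x
      using q_bound[of x] Cg(2)[of x] bound[of x] C_nonneg Cg(1)
      unfolding norm_scaleR abs_mult by (intro mult_mono) auto
  qed (use supp in auto)
  moreover have "integrable lborel (\<lambda>x. (\<rho> x *\<^sub>R \<Sigma> x) \<bullet> (\<chi> i. \<phi> x $ i *\<^sub>R (g x *\<^sub>R gq x)))"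
  proof (rule integrable_inner_bounded)
    show "set_integrable lborel K (\<lambda>x. \<rho> x *\<^sub>R \<Sigma> x)"
      using forward_eq K(1) by (auto simp: stationary_forward_equation_def locally_integrable_on_def)
    show "(\<lambda>x. \<chi> i. \<phi> x $ i *\<^sub>R (g x *\<^sub>R gq x)) \<in> borel_measurable borel"
      using gq_meas by (intro borel_measurable_vec_lambda) measurable
    show "norm (\<chi> i. \<phi> x $ i *\<^sub>R (g x *\<^sub>R gq x)) \<le> real CARD('n) * (C * (Cg * Cq))" for x
    proof -
      have "norm (\<phi> x $ i *\<^sub>R (g x *\<^sub>R gq x)) \<le> C * (Cg * Cq)" for i
        using order_trans[OF norm_nth_le bound] Cg Cq C_nonneg
        unfolding norm_scaleR by (intro mult_mono) (auto intro: order_trans[OF component_le_norm_cart bound])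
      then have "(\<Sum>i\<in>UNIV. norm ((\<chi> i. \<phi> x $ i *\<^sub>R (g x *\<^sub>R gq x)) $ i)) \<le> of_nat CARD('n) * (C * (Cg * Cq))"
        by (intro sum_bounded_above) simp
      then show ?thesis
        using norm_vec_le_sum order_trans by blast
    qed
  qed (use supp in \<open>auto simp: vec_eq_iff\<close>)
  ultimately have "integrable lborel (\<lambda>x. (\<rho> x *\<^sub>R (b x - c x)) \<bullet> ((q x * g x) *\<^sub>R \<phi> x)
      + (\<rho> x *\<^sub>R \<Sigma> x) \<bullet> (\<chi> i. \<phi> x $ i *\<^sub>R (g x *\<^sub>R gq x)))"
    by (rule Bochner_Integration.integrable_add)
  moreover have "(\<rho> x *\<^sub>R (b x - c x)) \<bullet> ((q x * g x) *\<^sub>R \<phi> x)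
      + (\<rho> x *\<^sub>R \<Sigma> x) \<bullet> (\<chi> i. \<phi> x $ i *\<^sub>R (g x *\<^sub>R gq x)) = drift x \<bullet> \<phi> x" for x
  proof (cases "x \<in> K")
    case True
    then show ?thesis
      using drift_inner[of x "\<phi> x"] K by (auto simp: gq_def)
  next
    case False
    then show ?thesis
      using supp[of x] by (simp add: inner_vec_def)
  qed
  ultimately show ?thesis
    by simp
qed

section \<open>The divergence part and local integrability\<close>

definition diffusive :: "real^'n::_ \<Rightarrow> real^'n::_" where
  "diffusive x = matrix_div (\<lambda>y. (\<rho> y * q y * g y) *\<^sub>R \<Sigma> y) x"

lemma diffusive_nth: "diffusive x $ i = (\<Sum>j\<in>UNIV. partial j (m i j) x)"
  by (simp add: diffusive_def matrix_div_def mult.commute)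

lemma transition_current_eq:
  "transition_current b \<sigma> F \<nu> \<rho> q g x = drift x + jump_flux F \<nu> G x - (1/2) *\<^sub>R diffusive x"
  by (simp add: transition_current_def drift_def diffusive_def)

lemma continuous_on_diffusive: "continuous_on S diffusive"
proof -
  have "continuous_on S (\<lambda>x. \<chi> i. diffusive x $ i)"
    unfolding diffusive_nth using m_C1 by (intro continuous_intros) auto
  then show ?thesis
    by simp
qed

lemma locally_integrable_current: "locally_integrable_on S (transition_current b \<sigma> F \<nu> \<rho> q g)"
  unfolding locally_integrable_on_def
proof safe
  fix K assume K: "compact K" "K \<subseteq> S"
  have "set_integrable lborel K drift"
    unfolding set_integrable_def
  proof (rule integrable_vec)
    fix i
    have K_sets [measurable]: "K \<in> sets borel"
      using K by (simp add: borel_compact)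
    \<comment> \<open>An axis vector cut off to \<open>K\<close> is an admissible test field and
      extracts one component of \<open>drift\<close>.\<close>
    have "integrable lborel (\<lambda>x. drift x \<bullet> (indicator K x *\<^sub>R axis i 1))"
      by (rule integrable_drift_inner[OF K, of _ 1]) (auto simp: indicator_def)
    then show "integrable lborel (\<lambda>x. (indicator K x *\<^sub>R drift x) $ i)"
      by (simp add: inner_axis mult.commute)
  qed
  moreover have "set_integrable lborel K (jump_flux F \<nu> G)"
    using flux.locally_integrable_jump_flux K unfolding locally_integrable_on_def by blast
  moreover have "set_integrable lborel K (\<lambda>x. (1/2) *\<^sub>R diffusive x)"
    unfolding set_integrable_def
    using K continuous_on_diffusive
    by (intro borel_integrable_compact continuous_intros) (auto intro: continuous_on_subset)
  ultimately show "set_integrable lborel K (transition_current b \<sigma> F \<nu> \<rho> q g)"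
    unfolding transition_current_eq[abs_def] by (intro set_integral_diff(1) set_integral_add(1))
qed

text \<open>\<open>h\<close> is the divergence of the field with components
  \<open>\<Sum>i. m i j * partial i f\<close>. Each summand is extended by 0 to a compactly
  supported \<open>C^1\<close> function on the whole space, so its derivative integrates to
  0.\<close>

lemma second_order_by_parts:
  assumes f: "f \<in> C2c S"
  defines "h \<equiv> \<lambda>x. (\<Sum>i\<in>UNIV. \<Sum>j\<in>UNIV. m i j x * partial i (partial j f) x) + diffusive x \<bullet> grad f x"
  shows "integrable lborel h" "(LINT x|lborel. h x) = 0"
proof -
  define w where "w = (\<lambda>i j x. m i j x * partial i f x)"
  have w: "Ck_on 1 UNIV (w i j)" "compact (closure {x. w i j x \<noteq> 0})" for i j
  proof -
    have sub: "closure {x. w i j x \<noteq> 0} \<subseteq> closure {x. f x \<noteq> 0}"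
      using closure_support_partial[of i f] closure_mono[of "{x. w i j x \<noteq> 0}" "{x. partial i f x \<noteq> 0}"]
      by (auto simp: w_def)
    have "Ck_on 1 S (partial i f)"
      by (rule Ck_on_subset[of 1 UNIV]) (use C2cD(1)[OF f] in \<open>simp_all add: numeral_2_eq_2\<close>)
    then have "Ck_on 1 S (w i j)"
      unfolding w_def by (rule Ck_on_mult[OF S_open m_C1])
    then show "Ck_on 1 UNIV (w i j)"
      by (rule Ck_on_UNIV_if_support[OF S_open _ order_trans[OF sub C2cD(3)[OF f]]])
    show "compact (closure {x. w i j x \<noteq> 0})"
      using closed_Int_compact[OF closed_closure C2cD(2)[OF f], of "{x. w i j x \<noteq> 0}"] unfolding Int_absorb2[OF sub] .
  qed
  have h: "h x = (\<Sum>i\<in>UNIV. \<Sum>j\<in>UNIV. partial j (w i j) x)" for x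
  proof (cases "x \<in> S")
    case True
    \<comment> \<open>The order of the two derivatives of \<open>f\<close> is exchanged by renaming
      indices and using the symmetry of \<open>\<Sigma>\<close>; symmetry of second derivatives is
      not invoked.\<close>
    have "(\<Sum>i\<in>UNIV. \<Sum>j\<in>UNIV. m i j x * partial i (partial j f) x) = (\<Sum>i\<in>UNIV. \<Sum>j\<in>UNIV. m j i x * partial i (partial j f) x)"
      by (intro sum.cong refl) (subst diffusion_matrix_symmetric, rule refl)
    also have "\<dots> = (\<Sum>j\<in>UNIV. \<Sum>i\<in>UNIV. m j i x * partial i (partial j f) x)"
      by (rule sum.swap)
    finally have "(\<Sum>i\<in>UNIV. \<Sum>j\<in>UNIV. m i j x * partial i (partial j f) x) = (\<Sum>i\<in>UNIV. \<Sum>j\<in>UNIV. m i j x * partial j (partial i f) x)" .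
    moreover have "diffusive x \<bullet> grad f x = (\<Sum>i\<in>UNIV. \<Sum>j\<in>UNIV. partial j (m i j) x * partial i f x)"
      by (simp add: inner_vec_def diffusive_nth grad_def sum_distrib_right)
    moreover have "partial j (w i j) x = partial j (m i j) x * partial i f x + m i j x * partial j (partial i f) x" for i j
      unfolding w_def using m_C1[of i j] True C2cD(6)[OF f] by (intro partial_mult) auto
    ultimately show ?thesis
      by (simp add: h_def sum.distrib)
  next
    case False
    then have notin: "x \<notin> closure {x. f x \<noteq> 0}"
      using C2cD(3)[OF f] by auto
    have "partial i (partial j f) x = 0" for i j
      using notin closure_support_partial[of j f] by (auto intro!: partial_support)
    moreover have "partial j (w i j) x = 0" for i j
      using notin closure_support_partial[of i f] closure_mono[of "{x. w i j x \<noteq> 0}" "{x. partial i f x \<noteq> 0}"]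
      by (intro partial_support) (auto simp: w_def)
    ultimately show ?thesis
      using grad_support[OF notin] by (simp add: h_def)
  qed
  show "integrable lborel h"
    unfolding h[abs_def] using integral_partial_eq_0(1)[OF w] by (intro Bochner_Integration.integrable_sum)
  show "(LINT x|lborel. h x) = 0"
    unfolding h using integral_partial_eq_0[OF w] by (simp add: Bochner_Integration.integral_sum Bochner_Integration.integrable_sum)
qed

section \<open>Assembly of the divergence form\<close>

lemma forward_divergence_form:
  "forward_divergence_form (generator b \<sigma> F \<nu>) q S (\<lambda>x. \<rho> x * g x) (transition_current b \<sigma> F \<nu> \<rho> q g)"
  unfolding forward_divergence_form_def
proof (intro conjI ballI)
  show "locally_integrable_on S (transition_current b \<sigma> F \<nu> \<rho> q g)"
    by (rule locally_integrable_current)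
  fix f assume f: "f \<in> C2c S"
  let ?K = "closure {x. f x \<noteq> 0}"
  let ?D = "doob_integrand (generator b \<sigma> F \<nu>) q (\<lambda>x. \<rho> x * g x) f"
  let ?J = "transition_current b \<sigma> F \<nu> \<rho> q g"
  note K = C2cD(2,3)[OF f]
  obtain C where C: "\<And>x. norm (grad f x) \<le> C"
    using bounded_if_continuous_support[OF C2cD(8)[OF f] K(1) grad_support] by blast
  have grad_meas: "grad f \<in> borel_measurable borel"
    using C2cD(8)[OF f] by (rule borel_measurable_continuous_onI)
  define \<psi> where "\<psi> = (\<lambda>x. LINT r:ball 0 1|\<nu>. LINT \<theta>:{0..1}|lborel. G x r \<bullet> grad f (x + \<theta> *\<^sub>R F x r))"
  \<comment> \<open>\<open>h\<close> pairs the second-order terms with the divergence term so that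
    the sum integrates to 0; half of it trades one for the other.\<close>
  define h where "h = (\<lambda>x. (\<Sum>i\<in>UNIV. \<Sum>j\<in>UNIV. m i j x * partial i (partial j f) x) + diffusive x \<bullet> grad f x)"
  note \<psi> = flux.integral_jump_flux_inner[OF K(1) grad_meas C grad_support, folded \<psi>_def]
  note h = second_order_by_parts[OF f, folded h_def]
  have int_drift: "integrable lborel (\<lambda>x. drift x \<bullet> grad f x)"
    by (rule integrable_drift_inner[OF K grad_meas C grad_support])
  have int_diffusive: "integrable lborel (\<lambda>x. diffusive x \<bullet> grad f x)"
    using K continuous_on_diffusive grad_meas C grad_support[of _ f]
    by (intro integrable_inner_bounded[of ?K _ _ C])
       (auto simp: set_integrable_def intro!: borel_integrable_compact intro: continuous_on_subset)
  \<comment> \<open>\<open>G x r\<close> is a multiple of the jump \<open>F x r\<close>, so the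
    \<theta>-integral is that multiple of the increment of \<open>f\<close> over the jump.\<close>
  have \<psi>_eq: "\<psi> x = \<rho> x * g x * (LINT r:ball 0 1|\<nu>. q (x + F x r) * (f (x + F x r) - f x))" for x
  proof -
    have "(LINT \<theta>:{0..1}|lborel. G x r \<bullet> grad f (x + \<theta> *\<^sub>R F x r)) = (\<rho> x * g x) * (q (x + F x r) * (f (x + F x r) - f x))" for r
      unfolding inner_scaleR_left set_integral_mult_right integral_grad_segment[OF C2cD(4)[OF f]]
      by (simp add: mult_ac)
    then show ?thesis
      unfolding \<psi>_def by (simp only: set_integral_mult_right)
  qed
  have D: "?D x = drift x \<bullet> grad f x + 1/2 * (h x - diffusive x \<bullet> grad f x) + \<psi> x" for x
  proof -
    have F_int: "set_integrable \<nu> (ball 0 1) (F x)"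
      using forward_eq by (simp add: stationary_forward_equation_def)
    have "\<bar>q y\<bar> \<le> 1" for y
      using q_bound[of y] by simp
    note gen = generator_mult[where F = F and x = x and b = b and \<sigma> = \<sigma>,
        OF sets_\<nu> S_open q_C2 this q_meas f F_section_meas F_int]
    \<comment> \<open>Either \<open>f x\<close> is 0, or \<open>x\<close> lies in \<open>S\<close>
      and the committor equation applies.\<close>
    have "f x * generator b \<sigma> F \<nu> q x = 0"
      using q_eq[of x] K(2) closure_subset[of "{x. f x \<noteq> 0}"] by (cases "f x = 0") auto
    moreover have "drift x \<bullet> grad f x = \<rho> x * g x * (q x * ((b x - c x) \<bullet> grad f x) + (\<Sigma> x *v grad q x) \<bullet> grad f x)"
    proof (cases "x \<in> S")
      case True
      show ?thesis
        unfolding drift_inner[OF True] diffusion_inner by (simp add: algebra_simps)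
    next
      case False
      then have "grad f x = 0"
        using K(2) by (intro grad_support) auto
      then show ?thesis
        by simp
    qed
    moreover have "h x - diffusive x \<bullet> grad f x = \<rho> x * g x * (\<Sum>i\<in>UNIV. \<Sum>j\<in>UNIV. \<Sigma> x $ i $ j * (q x * partial i (partial j f) x))"
      by (simp add: h_def sum_distrib_left mult_ac)
    ultimately show ?thesis
      unfolding doob_integrand_eq gen \<psi>_eq by (simp only: distrib_left mult.assoc)
  qed
  have J: "?J x \<bullet> grad f x = drift x \<bullet> grad f x + jump_flux F \<nu> G x \<bullet> grad f x - 1/2 * (diffusive x \<bullet> grad f x)" for x
    unfolding transition_current_eq by (simp add: inner_add_left inner_diff_left)
  show "integrable lborel ?D"
    unfolding D[abs_def] using int_drift h(1) int_diffusive \<psi>(1) by auto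
  \<comment> \<open>As \<open>h\<close> has integral 0, the second-order term contributes only minus
    half the divergence term, which is the sign in the current.\<close>
  have "(LINT x|lborel. ?D x) = (LINT x|lborel. drift x \<bullet> grad f x) - 1/2 * (LINT x|lborel. diffusive x \<bullet> grad f x) + (LINT x|lborel. \<psi> x)"
    unfolding D using int_drift h int_diffusive \<psi>(1) by simp
  also have "\<dots> = (LINT x|lborel. ?J x \<bullet> grad f x)"
    unfolding J using int_drift int_diffusive \<psi>(2,3) by simp
  also have "\<dots> = (LINT x:S|lborel. ?J x \<bullet> grad f x)"
    unfolding set_lebesgue_integral_def
  proof (rule Bochner_Integration.integral_cong[OF refl])
    fix x
    show "?J x \<bullet> grad f x = indicator S x *\<^sub>R (?J x \<bullet> grad f x)"
      using subsetD[OF K(2)] grad_support[of x f] by (cases "x \<in> closure {x. f x \<noteq> 0}") simp_all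
  qed
  finally show "(LINT x|lborel. ?D x) = (LINT x:S|lborel. ?J x \<bullet> grad f x)" .
qed

end

theorem theorem5:
  fixes M :: "'w measure" and \<F> :: "real \<Rightarrow> 'w measure"
    and W :: "real \<Rightarrow> 'w \<Rightarrow> real^'n::{finite,wellorder}"
    and \<nu> :: "(real^'m) measure"
    and N :: "'w \<Rightarrow> ((real^'m) \<times> real) measure"
    and b :: "real^'n::_ \<Rightarrow> real^'n::_" and \<sigma> :: "real^'n::_ \<Rightarrow> real^'n::_^'n::_"
    and F :: "real^'n::_ \<Rightarrow> real^'m \<Rightarrow> real^'n::_"
    and X :: "real^'n::_ \<Rightarrow> real \<Rightarrow> 'w \<Rightarrow> real^'n::_"
    and \<rho> q qb :: "real^'n::_ \<Rightarrow> real"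
    and A B \<Theta> :: "(real^'n::_) set"
    and \<U> :: "(real^'n::_ \<Rightarrow> real) set"
  defines "\<Theta> \<equiv> - (closure A \<union> closure B)"
  assumes space: "usual_filtration M \<F>"
    and bm: "brownian_motion M \<F> W"
    and levy: "levy_measure \<nu>"
    and prm: "poisson_random_measure M \<F> \<nu> N"
    and indep: "prob_space.indep_set M (path_events M W) (count_events M N UNIV)"
    and b_meas: "b \<in> borel_measurable borel"
    and \<sigma>_meas: "\<sigma> \<in> borel_measurable borel"
    and F_meas: "case_prod F \<in> borel_measurable borel"
    and sde: "\<And>x. solves_sde M \<F> W \<nu> N b \<sigma> F x (X x)"
    and markov: "markov_process M \<F> X"
    and invariant: "invariant_density M X \<rho>"
    and invariant_unique: "\<And>\<rho>'. invariant_density M X \<rho>' \<Longrightarrow> AE x in lborel. \<rho>' x = \<rho> x"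
    and ergodic: "ergodic_density M X \<rho>"
    and \<rho>_pos: "\<And>x. 0 < \<rho> x"
    and jump_maps: "regular_jump_maps F"
    and forward_eq: "stationary_forward_equation b \<sigma> F \<nu> \<rho>"
    and AB_open: "open A" "open B"
    and AB_disjoint: "A \<inter> B = {}"
    and AB_smooth: "smooth_boundary A" "smooth_boundary B"
    and AB_dist: "\<And>x y. x \<in> A \<Longrightarrow> y \<in> B \<Longrightarrow> 1 < norm (x - y)"
    and q_def: "q = forward_committor M X A B"
    and q_C2: "Ck_on 2 \<Theta> q"
    and q_strict: "\<And>x. x \<in> \<Theta> \<Longrightarrow> 0 < q x \<and> q x < 1"
    and q_eq: "\<And>x. x \<in> \<Theta> \<Longrightarrow> generator b \<sigma> F \<nu> q x = 0"
    and q_A: "\<And>x. x \<in> closure A \<Longrightarrow> q x = 0"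
    and q_B: "\<And>x. x \<in> closure B \<Longrightarrow> q x = 1"
    and qb_class: "qb \<in> \<U>"
    and qb_eq: "backward_committor_equation (generator b \<sigma> F \<nu>) \<rho> A B qb"
    and qb_unique: "\<And>g. g \<in> \<U> \<Longrightarrow>
           backward_committor_equation (generator b \<sigma> F \<nu>) \<rho> A B g \<Longrightarrow> g = qb"
    and qb_reg: "qb \<in> admissible_factors \<sigma> \<rho> q \<Theta>"
  shows "is_probability_current (generator b \<sigma> F \<nu>) \<rho> q \<Theta> (admissible_factors \<sigma> \<rho> q \<Theta>) qb
           (transition_current b \<sigma> F \<nu> \<rho> q)"
proof -
  have \<Theta>: "open \<Theta>"
    unfolding \<Theta>_def by (intro open_Compl closed_Un closed_closure)
  have q_meas: "q \<in> borel_measurable borel"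
    using Ck_on_imp_continuous_on[OF q_C2] q_A q_B unfolding \<Theta>_def by (rule borel_measurable_committor)
  have q_bound: "0 \<le> q x \<and> q x \<le> 1" for x
  proof (cases "x \<in> \<Theta>")
    case True
    then show ?thesis
      using q_strict[of x] by simp
  next
    case False
    then have "q x = 0 \<or> q x = 1"
      using q_A[of x] q_B[of x] unfolding \<Theta>_def by blast
    then show ?thesis
      by auto
  qed
  have \<rho>_meas: "\<rho> \<in> borel_measurable borel"
    using invariant by (simp add: invariant_density_def)
  \<comment> \<open>The backward committor is not yet involved: the factor \<open>g\<close> ranges
    over the full class, as the notion of current requires.\<close>
  have setting: "transition_setting \<nu> b \<sigma> F \<rho> q g \<Theta>" if "g \<in> admissible_factors \<sigma> \<rho> q \<Theta>" for g
    by (rule transition_setting.intro[OF levy F_meas jump_maps forward_eq \<rho>_meas less_imp_le[OF \<rho>_pos] \<Theta> q_meas q_C2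
          conjunct1[OF q_bound] conjunct2[OF q_bound] conjunct1[OF q_strict] q_eq that])
  have form: "forward_divergence_form (generator b \<sigma> F \<nu>) q \<Theta> (\<lambda>x. \<rho> x * g x) (transition_current b \<sigma> F \<nu> \<rho> q g)"
    if "g \<in> admissible_factors \<sigma> \<rho> q \<Theta>" for g
    by (rule transition_setting.forward_divergence_form[OF setting[OF that]])
  have stationary: "forward_stationary (generator b \<sigma> F \<nu>) q \<Theta> (\<lambda>x. \<rho> x * qb x)"
    unfolding forward_stationary_def
  proof (intro ballI conjI)
    fix f assume f: "f \<in> C2c \<Theta>"
    let ?\<mu> = "density lborel (\<lambda>y. ennreal (\<rho> y))"
    let ?h = "\<lambda>x. qb x * generator b \<sigma> F \<nu> (\<lambda>y. q y * f y) x"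
    \<comment> \<open>The backward committor equation is tested with \<open>q f\<close>. By
      \<open>doob_integrand_eq\<close> its integrand, multiplied by the density
      \<open>\<rho>\<close>, is exactly the one of the stationary equation.\<close>
    have qf: "(\<lambda>y. q y * f y) \<in> C2c \<Theta>"
      by (rule C2c_mult[OF \<Theta> q_C2 f])
    have D: "doob_integrand (generator b \<sigma> F \<nu>) q (\<lambda>x. \<rho> x * qb x) f = (\<lambda>x. \<rho> x *\<^sub>R ?h x)"
      by (rule ext) (simp only: doob_integrand_eq real_scaleR_def mult.assoc)
    have h: "integrable ?\<mu> ?h" "(LINT x|?\<mu>. ?h x) = 0"
      using qb_eq qf by (auto simp: backward_committor_equation_def adjoint_value_def \<Theta>_def)
    show D_int: "integrable lborel (doob_integrand (generator b \<sigma> F \<nu>) q (\<lambda>x. \<rho> x * qb x) f)"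
      using form[OF qb_reg] f by (simp add: forward_divergence_form_def)
    have "?h \<in> borel_measurable lborel"
      using borel_measurable_integrable[OF h(1)] by simp
    then have "(LINT x|?\<mu>. ?h x) = (LINT x|lborel. \<rho> x *\<^sub>R ?h x)"
      using \<rho>_meas \<rho>_pos by (intro integral_density) (auto intro: less_imp_le)
    with h(2) show "(LINT x|lborel. doob_integrand (generator b \<sigma> F \<nu>) q (\<lambda>x. \<rho> x * qb x) f x) = 0"
      unfolding D by simp
  qed
  \<comment> \<open>The same integral equals the current tested against \<open>grad f\<close> by the
    divergence form, and 0 by stationarity.\<close>
  have "divergence_free \<Theta> (transition_current b \<sigma> F \<nu> \<rho> q qb)"
    using form[OF qb_reg] stationary
    unfolding divergence_free_def forward_divergence_form_def forward_stationary_def by simp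
  with qb_reg form stationary show ?thesis
    by (simp add: is_probability_current_def)
qed

end
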